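(* Let $q\ge 1$ be fixed and let $\mathbf{\Sigma}$ be a fixed, known $q\times q$ positive definite matrix. For each $n\ge1$ let $\mathbf{X}_n$ be a (deterministic) $n\times p_n$ design matrix, let $\mathbf{B}_0=\mathbf{B}_{0n}\in\mathbb{R}^{p_n\times q}$ be the true coefficient matrix, and let the data be generated as $\mathbf{Y}_n=\mathbf{X}_n\mathbf{B}_0+\mathbf{E}_n$ with $\mathbf{E}_n\sim\mathcal{MN}_{n\times q}(\mathbf{O},\mathbf{I}_n,\mathbf{\Sigma})$; let $\mathbb{P}_0$ denote the distribution of $\{\mathbf{Y}_n\}_{n\ge1}$ under this true model. Let $\pi_n(\mathbf{B}_n)$ be any prior density on $\mathbb{R}^{p_n\times q}$ with distribution $\Pi_n$, and let $\Pi_n(\cdot\mid\mathbf{Y}_n)$ be the posterior under the likelihood $\mathbf{Y}_n\mid\mathbf{B}_n\sim\mathcal{MN}_{n\times q}(\mathbf{X}_n\mathbf{B}_n,\mathbf{I}_n,\mathbf{\Sigma})$. Assume: (A1) $p_n=o(n)$ and $p_n\le n$ for all $n\ge1$; (A2) there are constants $c_1,c_2$ with $0<c_1<\liminf_{n\to\infty}\lambda_{\min}(\mathbf{X}_n^\top\mathbf{X}_n/n)\le\limsup_{n\to\infty}\lambda_{\max}(\mathbf{X}_n^\top\mathbf{X}_n/n)<c_2<\infty$; (A3) there are constants $d_1,d_2$ with $0<d_1<\lambda_{\min}(\mathbf{\Sigma})\le\lambda_{\max}(\mathbf{\Sigma})<d_2<\infty$. Fix $\varepsilon>0$ and suppose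 there is $\rho>0$ such that for all $0<\Delta<\frac{\varepsilon^2c_1d_1^{1/2}}{48c_2^{1/2}d_2}$ and all $0<k<\frac{\varepsilon^2c_1}{32d_2}-\frac{3\Delta c_2^{1/2}}{2d_1^{1/2}}$, $$\Pi_n\Big(\mathbf{B}_n:\ \|\mathbf{B}_n-\mathbf{B}_0\|_F<\frac{\Delta}{n^{\rho/2}}\Big)>\exp(-kn)$$ for all sufficiently large $n$. Then $$\Pi_n\big(\mathbf{B}_n:\ \|\mathbf{B}_n-\mathbf{B}_0\|_F>\varepsilon\ \big|\ \mathbf{Y}_n\big)\to0\quad\text{almost surely }\mathbb{P}_0\text{ as }n\to\infty.$$
   Context: A random matrix $\mathbf{Y}\in\mathbb{R}^{a\times b}$ has the matrix-normal distribution $\mathcal{MN}_{a\times b}(\mathbf{M},\mathbf{U},\mathbf{V})$ (with $\mathbf{M}\in\mathbb{R}^{a\times b}$, $\mathbf{U}$, $\mathbf{V}$ positive definite of sizes $a\times a$, $b\times b$) if it has density $f(\mathbf{Y})=(2\pi)^{-ab/2}|\mathbf{U}|^{-b/2}|\mathbf{V}|^{-a/2}\exp\{-\tfrac12\mathrm{tr}[\mathbf{U}^{-1}(\mathbf{Y}-\mathbf{M})\mathbf{V}^{-1}(\mathbf{Y}-\mathbf{M})^\top]\}$. $\mathbf{O}$ denotes the zero matrix, $\|\cdot\|_F$ the Frobenius norm, and $\lambda_{\min},\lambda_{\max}$ the smallest and largest eigenvalues of a symmetric matrix. The number of predictors $p_n$ may grow with $n$. *)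

theory Defs
  imports "HOL-Probability.Probability" "HOL-Library.Landau_Symbols"
    "Jordan_Normal_Form.Matrix" "Jordan_Normal_Form.Determinant"
    "Jordan_Normal_Form.Char_Poly" "Jordan_Normal_Form.Gauss_Jordan_Elimination"
begin

definition mat_space :: "nat \<Rightarrow> nat \<Rightarrow> real mat measure" where
  "mat_space a b = embed_measure (PiM ({..<a} \<times> {..<b}) (\<lambda>_. lborel))
                                 (\<lambda>f. mat a b (\<lambda>ij. f ij))"

definition mat_trace :: "real mat \<Rightarrow> real" where
  "mat_trace A = (\<Sum>i<dim_row A. A $$ (i, i))"

definition mat_inv :: "real mat \<Rightarrow> real mat" where
  "mat_inv A = the (mat_inverse A)"

definition frob_norm :: "real mat \<Rightarrow> real" where
  "frob_norm A = sqrt (\<Sum>i<dim_row A. \<Sum>j<dim_col A. (A $$ (i, j))^2)"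

definition lambda_min :: "real mat \<Rightarrow> real" where
  "lambda_min A = Min {k. eigenvalue A k}"

definition lambda_max :: "real mat \<Rightarrow> real" where
  "lambda_max A = Max {k. eigenvalue A k}"

definition pos_def_mat :: "nat \<Rightarrow> real mat \<Rightarrow> bool" where
  "pos_def_mat m A \<longleftrightarrow> A \<in> carrier_mat m m \<and> transpose_mat A = A \<and>
     (\<forall>v \<in> carrier_vec m. v \<noteq> 0\<^sub>v m \<longrightarrow> v \<bullet> (A *\<^sub>v v) > 0)"

definition mn_density :: "real mat \<Rightarrow> real mat \<Rightarrow> real mat \<Rightarrow> real mat \<Rightarrow> real" where
  "mn_density M U V Y =
     (let a = dim_row M; b = dim_col M in
      (2 * pi) powr (- (real a * real b) / 2) * det U powr (- real b / 2) *
      det V powr (- real a / 2) *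
      exp (- 1/2 * mat_trace (mat_inv U * (Y - M) * mat_inv V * transpose_mat (Y - M))))"

definition prior_measure :: "nat \<Rightarrow> nat \<Rightarrow> (real mat \<Rightarrow> real) \<Rightarrow> real mat measure" where
  "prior_measure p q prior = density (mat_space p q) (\<lambda>B. ennreal (prior B))"

definition posterior_measure ::
  "real mat \<Rightarrow> real mat \<Rightarrow> nat \<Rightarrow> (real mat \<Rightarrow> real) \<Rightarrow> real mat \<Rightarrow> real mat measure" where
  "posterior_measure X S q prior Y =
     (let n = dim_row X; p = dim_col X;
          lik = (\<lambda>B. mn_density (X * B) (1\<^sub>m n) S Y);
          Z = (\<integral>\<^sup>+ B. ennreal (lik B) \<partial>prior_measure p q prior)
      in density (prior_measure p q prior) (\<lambda>B. ennreal (lik B) / Z))"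

end

theory Submission
  imports Defs
begin

text \<open>
  Write \<open>D = B - B\<^sub>0\<close>, \<open>C = \<Sigma>\<^sup>-\<^sup>1\<close> and let \<open>G = X\<^sup>T E C\<close> be the score at the truth. The likelihood
  ratio is \<open>exp (\<langle>G, D\<rangle> - Q D / 2)\<close>, where \<open>Q D = tr (X D C D\<^sup>T X\<^sup>T)\<close> lies between two multiples of
  \<open>n \<parallel>D\<parallel>\<^sup>2\<close>. Hence, once \<open>\<parallel>G\<parallel> \<le> \<delta> n\<close> for a small \<open>\<delta>\<close>, the ratio is at most \<open>exp (- \<eta> n)\<close> outside the
  \<open>\<epsilon>\<close>-ball, while the prior mass near \<open>B\<^sub>0\<close> keeps the evidence above \<open>exp (- \<eta> n / 2)\<close>.

  For the bound on \<open>G\<close>, completing the square and translation invariance of Lebesgue measure give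
  \<open>E exp \<langle>G, D\<rangle> = exp (Q D / 2) \<le> exp (L \<parallel>D\<parallel>\<^sup>2 / 2)\<close> with \<open>L\<close> of order \<open>n\<close>. Averaging this over an
  independent Gaussian \<open>D\<close> yields \<open>E exp (\<parallel>G\<parallel>\<^sup>2 / (4 L)) \<le> 2\<^bsup>pq/2\<^esup>\<close>, and as \<open>p = o(n)\<close> the events
  \<open>\<parallel>G\<parallel> > \<delta> n\<close> have summable probabilities whatever the dependence between different \<open>n\<close>.
\<close>

section \<open>Quadratic forms and eigenvalues of real symmetric matrices\<close>

no_notation inner (infix "\<bullet>" 70)

text \<open>Evaluate at the vertex \<open>t = - b / c\<close> of the parabola; for
  \<open>c = 0\<close>, an affine function that is nonnegative on the whole line has slope
  0.\<close>

lemma quadratic_nonneg_discriminant: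
  fixes a b c :: real
  assumes "\<And>t. a + 2 * t * b + t\<^sup>2 * c \<ge> 0" "c \<ge> 0"
  shows "b\<^sup>2 \<le> a * c"
proof (cases "c = 0")
  case True
  have "b = 0"
  proof (rule ccontr)
    assume "b \<noteq> 0"
    \<comment> \<open>At this \<open>t\<close> the affine function \<open>a + 2 * t * b\<close>
      equals -1.\<close>
    then show False
      using assms(1)[of "- (a + 1) / (2 * b)"] True by (simp add: field_simps)
  qed
  with True show ?thesis by simp
next
  case False
  with assms(2) have c: "c > 0" by simp
  have "a + 2 * (- b / c) * b + (- b / c)\<^sup>2 * c = a - b\<^sup>2 / c"
    using c by (simp add: field_simps power2_eq_square)
  with assms(1)[of "- b / c"] have "b\<^sup>2 / c \<le> a" by simp
  with c show ?thesis by (simp add: field_simps)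
qed

lemma scalar_prod_self_nonneg [simp]: "0 \<le> v \<bullet> (v :: real vec)"
  by (auto simp: scalar_prod_def intro: sum_nonneg)

lemma scalar_prod_Cauchy_Schwarz:
  assumes "(v :: real vec) \<in> carrier_vec n" "w \<in> carrier_vec n"
  shows "(v \<bullet> w)\<^sup>2 \<le> (v \<bullet> v) * (w \<bullet> w)"
  using assms Cauchy_Schwarz_ineq_sum[of "($) v" "($) w" "{0..<n}"]
  by (simp add: scalar_prod_def power2_eq_square)

lemma scalar_prod_two_le:
  assumes "(v :: real vec) \<in> carrier_vec n" "w \<in> carrier_vec n"
  shows "2 * \<bar>v \<bullet> w\<bar> \<le> v \<bullet> v + w \<bullet> w"
proof -
  have "2 * \<bar>v $ i * w $ i\<bar> \<le> v $ i * v $ i + w $ i * w $ i" for i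
    using sum_squares_bound[of "\<bar>v $ i\<bar>" "\<bar>w $ i\<bar>"] by (simp add: abs_mult power2_eq_square)
  then have "2 * (\<Sum>i\<in>{0..<n}. \<bar>v $ i * w $ i\<bar>)
      \<le> (\<Sum>i\<in>{0..<n}. v $ i * v $ i + w $ i * w $ i)"
    unfolding sum_distrib_left by (intro sum_mono)
  moreover have "\<bar>\<Sum>i\<in>{0..<n}. v $ i * w $ i\<bar> \<le> (\<Sum>i\<in>{0..<n}. \<bar>v $ i * w $ i\<bar>)"
    by (rule sum_abs)
  ultimately have "2 * \<bar>\<Sum>i\<in>{0..<n}. v $ i * w $ i\<bar>
      \<le> (\<Sum>i\<in>{0..<n}. v $ i * v $ i + w $ i * w $ i)" by linarith
  then show ?thesis
    using assms by (simp add: scalar_prod_def sum.distrib)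
qed

text \<open>Cauchy-Schwarz on each row: the squared Frobenius norm of \<open>A\<close> serves as the
  bound.\<close>

lemma mult_mat_vec_bounded:
  assumes A: "(A :: real mat) \<in> carrier_mat m n"
  obtains K where "K > 0" "\<And>v. v \<in> carrier_vec n \<Longrightarrow> (A *\<^sub>v v) \<bullet> (A *\<^sub>v v) \<le> K * (v \<bullet> v)"
proof
  let ?K = "\<Sum>i\<in>{0..<m}. row A i \<bullet> row A i"
  \<comment> \<open>The extra 1 keeps the constant positive when \<open>A\<close> vanishes.\<close>
  show "?K + 1 > 0" by (intro add_nonneg_pos sum_nonneg) auto
  fix v :: "real vec" assume v: "v \<in> carrier_vec n"
  have "(A *\<^sub>v v) \<bullet> (A *\<^sub>v v) = (\<Sum>i\<in>{0..<m}. (row A i \<bullet> v)\<^sup>2)"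
    using A by (simp add: scalar_prod_def[of "A *\<^sub>v v"] power2_eq_square)
  also have "\<dots> \<le> (\<Sum>i\<in>{0..<m}. (row A i \<bullet> row A i) * (v \<bullet> v))"
    by (intro sum_mono scalar_prod_Cauchy_Schwarz) (use A v in auto)
  also have "\<dots> = ?K * (v \<bullet> v)" by (simp add: sum_distrib_right)
  also have "\<dots> \<le> (?K + 1) * (v \<bullet> v)" by (intro mult_right_mono) auto
  finally show "(A *\<^sub>v v) \<bullet> (A *\<^sub>v v) \<le> (?K + 1) * (v \<bullet> v)" .
qed

lemma quadratic_form_bounded:
  assumes A: "(A :: real mat) \<in> carrier_mat n n"
  obtains K where "K > 0" "\<And>v. v \<in> carrier_vec n \<Longrightarrow> \<bar>v \<bullet> (A *\<^sub>v v)\<bar> \<le> K * (v \<bullet> v)"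
proof -
  obtain K where K: "K > 0" "\<And>v. v \<in> carrier_vec n \<Longrightarrow> (A *\<^sub>v v) \<bullet> (A *\<^sub>v v) \<le> K * (v \<bullet> v)"
    using mult_mat_vec_bounded[OF A] by blast
  show ?thesis
  proof (rule that)
    show "(1 + K) / 2 > 0" using K by simp
    fix v :: "real vec" assume v: "v \<in> carrier_vec n"
    then show "\<bar>v \<bullet> (A *\<^sub>v v)\<bar> \<le> (1 + K) / 2 * (v \<bullet> v)"
      using scalar_prod_two_le[of v n "A *\<^sub>v v"] K(2)[OF v] A by (simp add: algebra_simps)
  qed
qed

lemma symmetric_form_commute:
  assumes "(A :: real mat) \<in> carrier_mat n n" "transpose_mat A = A"
    and "v \<in> carrier_vec n" "w \<in> carrier_vec n"
  shows "v \<bullet> (A *\<^sub>v w) = w \<bullet> (A *\<^sub>v v)"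
  using transpose_vec_mult_scalar[of A n n w v] assms
  by (metis mult_mat_vec_carrier comm_scalar_prod)

text \<open>The form at \<open>v + t w\<close> is a nonnegative quadratic polynomial in
  \<open>t\<close>, so the discriminant criterion applies.\<close>

lemma psd_form_Cauchy_Schwarz:
  assumes A: "(A :: real mat) \<in> carrier_mat n n" "transpose_mat A = A"
    and psd: "\<And>v. v \<in> carrier_vec n \<Longrightarrow> v \<bullet> (A *\<^sub>v v) \<ge> 0"
    and v: "v \<in> carrier_vec n" and w: "w \<in> carrier_vec n"
  shows "(v \<bullet> (A *\<^sub>v w))\<^sup>2 \<le> (v \<bullet> (A *\<^sub>v v)) * (w \<bullet> (A *\<^sub>v w))"
proof (rule quadratic_nonneg_discriminant)
  fix t :: real
  have "(v + t \<cdot>\<^sub>v w) \<bullet> (A *\<^sub>v (v + t \<cdot>\<^sub>v w))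
      = v \<bullet> (A *\<^sub>v v) + 2 * t * (v \<bullet> (A *\<^sub>v w)) + t\<^sup>2 * (w \<bullet> (A *\<^sub>v w))"
    using A v w symmetric_form_commute[OF A v w]
    by (simp add: mult_add_distrib_mat_vec[of _ n n] mult_mat_vec[of _ n n]
        scalar_prod_add_distrib[of _ n] add_scalar_prod_distrib[of _ n]
        power2_eq_square algebra_simps)
  then show "v \<bullet> (A *\<^sub>v v) + 2 * t * (v \<bullet> (A *\<^sub>v w)) + t\<^sup>2 * (w \<bullet> (A *\<^sub>v w)) \<ge> 0"
    using psd[of "v + t \<cdot>\<^sub>v w"] v w by simp
qed (use psd w in auto)

lemma mat_inv_of_det_nonzero:
  assumes A: "(A :: real mat) \<in> carrier_mat n n" and "det A \<noteq> 0"
  shows "mat_inv A \<in> carrier_mat n n" "A * mat_inv A = 1\<^sub>m n" "mat_inv A * A = 1\<^sub>m n"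
proof -
  have "mat_inverse A \<noteq> None"
    \<comment> \<open>Both facts carry a dummy parameter of the matrix ring; instantiating it with
      \<open>()\<close> makes them speak of the same ring.\<close>
    using mat_inverse(1)[OF A, of "()"] det_non_zero_imp_unit[OF A assms(2), of "()"] by blast
  then obtain B where "mat_inverse A = Some B" by blast
  then show "mat_inv A \<in> carrier_mat n n" "A * mat_inv A = 1\<^sub>m n" "mat_inv A * A = 1\<^sub>m n"
    using mat_inverse(2)[OF A] by (auto simp: mat_inv_def)
qed

text \<open>With \<open>w = A v\<close>, Cauchy-Schwarz for the form of \<open>A\<close> gives |w|^4
  <= (w . A w) (v . A v) <= L |w|^2 (v . A v), hence |w|^2 <= L (v . A v). Boundedness of the
  inverse gives |v|^2 <= K |w|^2, so 1 / (K L) is a coercivity constant. No diagonalisation is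
  involved.\<close>

lemma psd_invertible_coercive:
  assumes A: "(A :: real mat) \<in> carrier_mat n n" "transpose_mat A = A"
    and psd: "\<And>v. v \<in> carrier_vec n \<Longrightarrow> v \<bullet> (A *\<^sub>v v) \<ge> 0"
    and det: "det A \<noteq> 0"
  obtains \<kappa> where "\<kappa> > 0" "\<And>v. v \<in> carrier_vec n \<Longrightarrow> \<kappa> * (v \<bullet> v) \<le> v \<bullet> (A *\<^sub>v v)"
proof -
  note C = mat_inv_of_det_nonzero[OF A(1) det]
  obtain K where K: "K > 0"
    "\<And>v. v \<in> carrier_vec n \<Longrightarrow> (mat_inv A *\<^sub>v v) \<bullet> (mat_inv A *\<^sub>v v) \<le> K * (v \<bullet> v)"
    using mult_mat_vec_bounded[OF C(1)] by blast
  obtain L where L: "L > 0" "\<And>v. v \<in> carrier_vec n \<Longrightarrow> \<bar>v \<bullet> (A *\<^sub>v v)\<bar> \<le> L * (v \<bullet> v)"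
    using quadratic_form_bounded[OF A(1)] by blast
  show ?thesis
  proof (rule that)
    show "1 / (K * L) > 0" using K L by simp
    fix v :: "real vec" assume v: "v \<in> carrier_vec n"
    define w where "w = A *\<^sub>v v"
    have w: "w \<in> carrier_vec n" using A v by (simp add: w_def)
    have "mat_inv A *\<^sub>v w = v"
      unfolding w_def using C A v
      by (metis assoc_mult_mat_vec one_mult_mat_vec)
    with K(2)[OF w] have vw: "v \<bullet> v \<le> K * (w \<bullet> w)" by simp
    have "(w \<bullet> w)\<^sup>2 \<le> (w \<bullet> (A *\<^sub>v w)) * (v \<bullet> (A *\<^sub>v v))"
      using psd_form_Cauchy_Schwarz[OF A psd w v] by (simp add: w_def)
    also have "\<dots> \<le> (L * (w \<bullet> w)) * (v \<bullet> (A *\<^sub>v v))"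
      using L(2)[OF w] psd[OF v] by (intro mult_right_mono) auto
    finally have "(w \<bullet> w) * (w \<bullet> w) \<le> (w \<bullet> w) * (L * (v \<bullet> (A *\<^sub>v v)))"
      by (simp add: power2_eq_square algebra_simps)
    then have "w \<bullet> w \<le> L * (v \<bullet> (A *\<^sub>v v))"
      using psd[OF v] L(1) scalar_prod_self_nonneg[of w]
      by (cases "w \<bullet> w = 0") (auto simp: mult_le_cancel_left)
    then have "K * (w \<bullet> w) \<le> K * (L * (v \<bullet> (A *\<^sub>v v)))"
      using K(1) by (intro mult_left_mono) auto
    with vw have "v \<bullet> v \<le> K * (L * (v \<bullet> (A *\<^sub>v v)))" by simp
    with K(1) L(1) show "1 / (K * L) * (v \<bullet> v) \<le> v \<bullet> (A *\<^sub>v v)"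
      by (simp add: field_simps)
  qed
qed

text \<open>
  No compactness of the sphere is needed: if \<open>m\<close> is the largest shift for which \<open>A - m\<close> is positive
  semidefinite, then \<open>A - m\<close> is singular, since otherwise it is coercive and \<open>m\<close> could be increased.
\<close>

lemma symmetric_least_eigenvalue:
  assumes A: "(A :: real mat) \<in> carrier_mat n n" "transpose_mat A = A" and n: "n > 0"
  obtains m where "eigenvalue A m" "\<And>v. v \<in> carrier_vec n \<Longrightarrow> m * (v \<bullet> v) \<le> v \<bullet> (A *\<^sub>v v)"
proof -
  define S where "S = {t. \<forall>v\<in>carrier_vec n. t * (v \<bullet> v) \<le> v \<bullet> (A *\<^sub>v v)}"
  define m where "m = Sup S"
  obtain K where K: "K > 0" "\<And>v. v \<in> carrier_vec n \<Longrightarrow> \<bar>v \<bullet> (A *\<^sub>v v)\<bar> \<le> K * (v \<bullet> v)"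
    using quadratic_form_bounded[OF A(1)] by blast
  have "- K \<in> S" unfolding S_def using K(2) by fastforce
  then have ne: "S \<noteq> {}" by blast
  have e: "unit_vec n 0 \<bullet> unit_vec n 0 = (1 :: real)" using n by simp
  have bdd: "bdd_above S"
    by (rule bdd_aboveI[of _ "unit_vec n 0 \<bullet> (A *\<^sub>v unit_vec n 0)"])
      (use e in \<open>auto simp: S_def dest!: bspec[of _ _ "unit_vec n 0"]\<close>)
  \<comment> \<open>The supremum belongs to \<open>S\<close>: every Rayleigh quotient is an upper
    bound of \<open>S\<close>.\<close>
  have mS: "m * (v \<bullet> v) \<le> v \<bullet> (A *\<^sub>v v)" if v: "v \<in> carrier_vec n" for v
  proof (cases "v \<bullet> v = 0")
    case True
    then show ?thesis using K(2)[OF v] by simp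
  next
    case False
    then have pos: "v \<bullet> v > 0" using scalar_prod_self_nonneg[of v] by linarith
    have "m \<le> (v \<bullet> (A *\<^sub>v v)) / (v \<bullet> v)"
      unfolding m_def using v pos
      by (intro cSup_least[OF ne]) (auto simp: S_def field_simps)
    then show ?thesis using pos by (simp add: field_simps)
  qed
  \<comment> \<open>\<open>char_matrix A m\<close> is A - m I, and its singularity is what makes
    \<open>m\<close> an eigenvalue.\<close>
  define B where "B = char_matrix A m"
  have B: "B \<in> carrier_mat n n" using A by (simp add: B_def)
  have Bv: "v \<bullet> (B *\<^sub>v v) = v \<bullet> (A *\<^sub>v v) - m * (v \<bullet> v)" if v: "v \<in> carrier_vec n" for v
  proof -
    have "B *\<^sub>v v = A *\<^sub>v v + (- m) \<cdot>\<^sub>v v"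
      using A v unfolding B_def char_matrix_def
      by (subst add_mult_distrib_mat_vec[of _ n n]) (auto simp: scalar_prod_def sum_negf
          mult.assoc if_distrib[of "\<lambda>x. m * (x * _)"] intro!: eq_vecI cong: if_cong)
    then show ?thesis using A v
      by (simp add: scalar_prod_add_distrib[of _ n])
  qed
  have "transpose_mat B = B"
  proof (rule eq_matI)
    fix i j assume "i < dim_row B" "j < dim_col B"
    moreover from this have "A $$ (i, j) = A $$ (j, i)"
      using A B by (metis carrier_matD index_transpose_mat(1))
    ultimately show "transpose_mat B $$ (i, j) = B $$ (i, j)"
      using A B by (auto simp: B_def char_matrix_def)
  qed (use B in auto)
  have "det B = 0"
  proof (rule ccontr)
    assume "det B \<noteq> 0"
    then obtain \<kappa> where \<kappa>: "\<kappa> > 0" "\<And>v. v \<in> carrier_vec n \<Longrightarrow> \<kappa> * (v \<bullet> v) \<le> v \<bullet> (B *\<^sub>v v)"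
      using psd_invertible_coercive[OF B \<open>transpose_mat B = B\<close>] Bv mS by (metis diff_ge_0_iff_ge)
    have "m + \<kappa> \<in> S" unfolding S_def using \<kappa>(2) Bv by (force simp: algebra_simps)
    then have "m + \<kappa> \<le> m" unfolding m_def by (rule cSup_upper[OF _ bdd])
    with \<kappa>(1) show False by simp
  qed
  then have "eigenvalue A m" using eigenvalue_det[OF A(1)] by (simp add: B_def)
  with mS show ?thesis by (rule that[rotated])
qed

text \<open>\<open>Min\<close> and \<open>Max\<close> in the definitions of the extreme eigenvalues
  can be compared with a member of the set only when that set is finite.\<close>

lemma finite_eigenvalues:
  assumes "(A :: real mat) \<in> carrier_mat n n"
  shows "finite {k. eigenvalue A k}"
proof -
  have "char_poly A \<noteq> 0" using degree_monic_char_poly[OF assms] by auto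
  then show ?thesis
    unfolding eigenvalue_root_char_poly[OF assms] by (rule poly_roots_finite)
qed

text \<open>Some eigenvalue bounds the Rayleigh quotient from below, and the minimum over all
  eigenvalues is no larger.\<close>

lemma lambda_min_le_form:
  assumes A: "(A :: real mat) \<in> carrier_mat n n" "transpose_mat A = A"
    and v: "v \<in> carrier_vec n"
  shows "lambda_min A * (v \<bullet> v) \<le> v \<bullet> (A *\<^sub>v v)"
proof (cases "n = 0")
  \<comment> \<open>In dimension 0 there are no eigenvalues and \<open>lambda_min\<close> is an
    unspecified value, but it is multiplied by an empty sum.\<close>
  case True
  then show ?thesis using v A by (simp add: scalar_prod_def)
next
  case False
  then obtain m where m: "eigenvalue A m" "m * (v \<bullet> v) \<le> v \<bullet> (A *\<^sub>v v)"
    using symmetric_least_eigenvalue[OF A] v by blast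
  have "lambda_min A \<le> m"
    unfolding lambda_min_def using finite_eigenvalues[OF A(1)] m(1) by simp
  then have "lambda_min A * (v \<bullet> v) \<le> m * (v \<bullet> v)"
    by (intro mult_right_mono) auto
  with m(2) show ?thesis by simp
qed

text \<open>Apply the least-eigenvalue result to \<open>- A\<close>: the eigenvalue obtained there
  is minus an eigenvalue of \<open>A\<close>.\<close>

lemma form_le_lambda_max:
  assumes A: "(A :: real mat) \<in> carrier_mat n n" "transpose_mat A = A"
    and v: "v \<in> carrier_vec n"
  shows "v \<bullet> (A *\<^sub>v v) \<le> lambda_max A * (v \<bullet> v)"
proof (cases "n = 0")
  case True
  then show ?thesis using v A by (simp add: scalar_prod_def)
next
  case False
  have A': "- A \<in> carrier_mat n n" "transpose_mat (- A) = - A"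
    using A by (auto simp: transpose_uminus)
  have neg: "(- A) *\<^sub>v w = - (A *\<^sub>v w)" if "w \<in> carrier_vec n" for w
    using A that by auto
  obtain m where m: "eigenvalue (- A) m" "m * (v \<bullet> v) \<le> v \<bullet> ((- A) *\<^sub>v v)"
    using symmetric_least_eigenvalue[OF A'] v False by blast
  from m(1) obtain w where w: "w \<in> carrier_vec n" "w \<noteq> 0\<^sub>v n" "(- A) *\<^sub>v w = m \<cdot>\<^sub>v w"
    using A by (auto simp: eigenvalue_def eigenvector_def)
  have "A *\<^sub>v w = - ((- A) *\<^sub>v w)" unfolding neg[OF w(1)] by simp
  also have "\<dots> = (- m) \<cdot>\<^sub>v w" unfolding w(3) by (rule eq_vecI) auto
  finally have "eigenvalue A (- m)"
    using w A by (auto simp: eigenvalue_def eigenvector_def)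
  then have "- m \<le> lambda_max A"
    unfolding lambda_max_def using finite_eigenvalues[OF A(1)] by simp
  then have "(- m) * (v \<bullet> v) \<le> lambda_max A * (v \<bullet> v)"
    by (intro mult_right_mono) auto
  moreover have "v \<bullet> ((- A) *\<^sub>v v) = - (v \<bullet> (A *\<^sub>v v))"
    using v A by (simp add: neg)
  ultimately show ?thesis using m(2) by simp
qed

section \<open>Lebesgue measure on matrices\<close>

abbreviation entry_space :: "nat \<Rightarrow> nat \<Rightarrow> (nat \<times> nat \<Rightarrow> real) measure" where
  "entry_space a b \<equiv> PiM ({..<a} \<times> {..<b}) (\<lambda>_. lborel)"

text \<open>The condition under which integrals transfer along \<open>embed_measure\<close>; it
  holds because elements of the product space are extensional, hence determined by the entries that
  \<open>mat\<close> keeps.\<close>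

lemma inj_on_mat_entry_space: "inj_on (mat a b) (space (entry_space a b))"
proof (rule inj_onI)
  fix f g assume f: "f \<in> space (entry_space a b)" and g: "g \<in> space (entry_space a b)"
    and eq: "mat a b f = mat a b g"
  have "f x = g x" if "x \<in> {..<a} \<times> {..<b}" for x
    using that arg_cong[OF eq, of "\<lambda>A. A $$ x"] by (cases x) auto
  then show "f = g"
    using f g by (intro PiE_ext[of f "{..<a} \<times> {..<b}" "\<lambda>_. UNIV" g]) (auto simp: space_PiM)
qed

lemma mat_space_eq_embed: "mat_space a b = embed_measure (entry_space a b) (mat a b)"
  by (simp add: mat_space_def)

lemma measurable_mat_space:
  "(\<lambda>x. f (mat a b x)) \<in> measurable (entry_space a b) N \<Longrightarrow> f \<in> measurable (mat_space a b) N"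
  unfolding mat_space_eq_embed by (rule measurable_embed_measure1)

lemma nn_integral_mat_space:
  assumes "f \<in> borel_measurable (mat_space a b)"
  shows "(\<integral>\<^sup>+ A. f A \<partial>mat_space a b) = (\<integral>\<^sup>+ x. f (mat a b x) \<partial>entry_space a b)"
  using assms nn_integral_embed_measure'[OF inj_on_mat_entry_space]
  unfolding mat_space_eq_embed by blast

lemma measurable_mat_entry_space: "mat a b \<in> measurable (entry_space a b) (mat_space a b)"
  unfolding mat_space_eq_embed by (rule measurable_embed_measure2'[OF inj_on_mat_entry_space])

lemma space_mat_space: "space (mat_space a b) = carrier_mat a b"
proof
  show "space (mat_space a b) \<subseteq> carrier_mat a b"
    by (auto simp: mat_space_eq_embed space_embed_measure)
  show "carrier_mat a b \<subseteq> space (mat_space a b)"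
  proof
    fix A :: "real mat" assume A: "A \<in> carrier_mat a b"
    have "A = mat a b (restrict (($$) A) ({..<a} \<times> {..<b}))"
      using A by (intro eq_matI) auto
    moreover have "restrict (($$) A) ({..<a} \<times> {..<b}) \<in> space (entry_space a b)"
      by (auto simp: space_PiM)
    ultimately show "A \<in> space (mat_space a b)"
      by (auto simp: mat_space_eq_embed space_embed_measure)
  qed
qed

lemma measurable_mat_entry:
  assumes "i < a" "j < b"
  shows "(\<lambda>A. A $$ (i, j)) \<in> borel_measurable (mat_space a b)"
proof (rule measurable_mat_space)
  have "(\<lambda>x. x (i, j)) \<in> borel_measurable (entry_space a b)"
    using assms measurable_component_singleton[of "(i, j)" "{..<a} \<times> {..<b}" "\<lambda>_. lborel"] by simp
  then show "(\<lambda>x. mat a b x $$ (i, j)) \<in> borel_measurable (entry_space a b)"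
    using assms by simp
qed

text \<open>A product measure is determined by its values on boxes; the shift moves each side
  separately, and one-dimensional Lebesgue measure is translation invariant.\<close>

lemma entry_space_translation:
  "distr (entry_space a b) (entry_space a b)
     (\<lambda>x. \<lambda>i\<in>{..<a} \<times> {..<b}. x i - c i) = entry_space a b" (is "distr ?P ?P ?T = ?P")
proof -
  interpret product_sigma_finite "\<lambda>_ :: nat \<times> nat. lborel :: real measure"
    by (simp add: product_sigma_finite_def sigma_finite_lborel)
  let ?I = "{..<a} \<times> {..<b}"
  have comp: "(\<lambda>x. x i) \<in> borel_measurable ?P" if "i \<in> ?I" for i
    using measurable_component_singleton[OF that, of "\<lambda>_. lborel"] by simp
  have T: "?T \<in> measurable ?P ?P"
    by (rule measurable_restrict) (simp add: comp)
  show ?thesis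
  proof (rule PiM_eqI)
    fix A :: "nat \<times> nat \<Rightarrow> real set" assume A: "\<And>i. i \<in> ?I \<Longrightarrow> A i \<in> sets lborel"
    let ?B = "\<lambda>i. (\<lambda>y. y - c i) -` A i"
    have B: "?B i \<in> sets lborel" if "i \<in> ?I" for i
      using measurable_sets[of "\<lambda>y :: real. y - c i" lborel lborel "A i"] A[OF that] by simp
    have "emeasure (distr ?P ?P ?T) (Pi\<^sub>E ?I A) = emeasure ?P (?T -` Pi\<^sub>E ?I A \<inter> space ?P)"
      using A by (intro emeasure_distr[OF T] sets_PiM_I_finite) auto
    also have "?T -` Pi\<^sub>E ?I A \<inter> space ?P = Pi\<^sub>E ?I ?B"
      by (auto simp: space_PiM PiE_iff)
    also have "emeasure ?P (Pi\<^sub>E ?I ?B) = (\<Prod>i\<in>?I. emeasure lborel (?B i))"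
      using B by (intro emeasure_PiM) auto
    also have "\<dots> = (\<Prod>i\<in>?I. emeasure lborel (A i))"
    proof (rule prod.cong[OF refl])
      fix i assume i: "i \<in> ?I"
      have "emeasure lborel (A i) = emeasure (distr lborel borel ((+) (- c i))) (A i)"
        by (simp add: lborel_distr_plus)
      also have "\<dots> = emeasure lborel (?B i)"
        using A[OF i] by (subst emeasure_distr) (auto intro!: arg_cong[where f = "emeasure lborel"])
      finally show "emeasure lborel (?B i) = emeasure lborel (A i)" ..
    qed
    finally show "emeasure (distr ?P ?P ?T) (Pi\<^sub>E ?I A) = (\<Prod>i\<in>?I. emeasure lborel (A i))" .
  qed auto
qed

text \<open>Written in entries, subtracting \<open>H\<close> is a coordinate shift, which preserves
  the product measure.\<close>

lemma nn_integral_mat_space_translation: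
  assumes f: "f \<in> borel_measurable (mat_space a b)"
    and g: "(\<lambda>Y. f (Y - H)) \<in> borel_measurable (mat_space a b)" and H: "H \<in> carrier_mat a b"
  shows "(\<integral>\<^sup>+ Y. f (Y - H) \<partial>mat_space a b) = (\<integral>\<^sup>+ Y. f Y \<partial>mat_space a b)"
proof -
  let ?I = "{..<a} \<times> {..<b}" and ?P = "entry_space a b"
  let ?T = "\<lambda>x. \<lambda>i\<in>?I. x i - H $$ i"
  have comp: "(\<lambda>x. x i) \<in> borel_measurable ?P" if "i \<in> ?I" for i
    using measurable_component_singleton[OF that, of "\<lambda>_. lborel"] by simp
  have T: "?T \<in> measurable ?P ?P"
    by (rule measurable_restrict) (simp add: comp)
  have shift: "mat a b x - H = mat a b (?T x)" for x
    using H by (intro eq_matI) auto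
  have "(\<integral>\<^sup>+ Y. f Y \<partial>mat_space a b) = (\<integral>\<^sup>+ x. f (mat a b x) \<partial>distr ?P ?P ?T)"
    by (simp add: nn_integral_mat_space[OF f] entry_space_translation)
  also have "\<dots> = (\<integral>\<^sup>+ x. f (mat a b (?T x)) \<partial>?P)"
    using measurable_compose[OF measurable_mat_entry_space f] by (subst nn_integral_distr[OF T]) auto
  also have "\<dots> = (\<integral>\<^sup>+ Y. f (Y - H) \<partial>mat_space a b)"
    by (simp add: nn_integral_mat_space[OF g] shift)
  finally show ?thesis ..
qed

section \<open>Norms of sub-Gaussian vectors\<close>

text \<open>Completing the square turns the integrand into exp(s^2 / 2) times the normal density
  with mean \<open>s\<close>.\<close>

lemma std_normal_mgf:
  "(\<integral>\<^sup>+ z. ennreal (std_normal_density z * exp (s * z)) \<partial>lborel) = ennreal (exp (s\<^sup>2 / 2))"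
proof -
  have "std_normal_density z * exp (s * z) = exp (s\<^sup>2 / 2) * normal_density s 1 z" for z
    by (simp add: normal_density_def exp_add[symmetric] field_simps power2_eq_square)
  then have "(\<integral>\<^sup>+ z. ennreal (std_normal_density z * exp (s * z)) \<partial>lborel)
      = (\<integral>\<^sup>+ z. ennreal (exp (s\<^sup>2 / 2)) * ennreal (normal_density s 1 z) \<partial>lborel)"
    by (simp add: ennreal_mult)
  also have "\<dots> = ennreal (exp (s\<^sup>2 / 2)) * (\<integral>\<^sup>+ z. ennreal (normal_density s 1 z) \<partial>lborel)"
    by (rule nn_integral_cmult) simp
  also have "(\<integral>\<^sup>+ z. ennreal (normal_density s 1 z) \<partial>lborel) = 1"
    using integrable_normal_density[of 1 s] integral_normal_density[of 1 s]
    by (subst nn_integral_eq_integral) auto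
  finally show ?thesis by simp
qed

text \<open>The integrand is sqrt 2 times the normal density with variance 2.\<close>

lemma std_normal_exp_square:
  "(\<integral>\<^sup>+ z. ennreal (std_normal_density z * exp (z\<^sup>2 / 4)) \<partial>lborel) = ennreal (sqrt 2)"
proof -
  have "std_normal_density z * exp (z\<^sup>2 / 4) = sqrt 2 * normal_density 0 (sqrt 2) z" for z
    by (simp add: normal_density_def exp_add[symmetric] field_simps real_sqrt_mult)
  then have "(\<integral>\<^sup>+ z. ennreal (std_normal_density z * exp (z\<^sup>2 / 4)) \<partial>lborel)
      = (\<integral>\<^sup>+ z. ennreal (sqrt 2) * ennreal (normal_density 0 (sqrt 2) z) \<partial>lborel)"
    by (simp add: ennreal_mult)
  also have "\<dots> = ennreal (sqrt 2) * (\<integral>\<^sup>+ z. ennreal (normal_density 0 (sqrt 2) z) \<partial>lborel)"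
    by (rule nn_integral_cmult) simp
  also have "(\<integral>\<^sup>+ z. ennreal (normal_density 0 (sqrt 2) z) \<partial>lborel) = 1"
    using integrable_normal_density[of "sqrt 2" 0] integral_normal_density[of "sqrt 2" 0]
    by (subst nn_integral_eq_integral) auto
  finally show ?thesis by simp
qed

text \<open>The squared norm is linearised by an independent standard Gaussian vector
  \<open>z\<close>: integrating exp(s <z, G>) over \<open>z\<close> gives exp(s^2 |G|^2 / 2). After
  exchanging the integrals, the bound on the moment generating function is applied for fixed
  \<open>z\<close>, and what remains is a product of one-dimensional integrals, each equal to sqrt
  2.\<close>

lemma subgaussian_exp_square:
  fixes G :: "'i \<Rightarrow> 'w \<Rightarrow> real"
  assumes "sigma_finite_measure M" and I: "finite I" and L: "L > 0"
    and G: "\<And>i. i \<in> I \<Longrightarrow> G i \<in> borel_measurable M"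
    and mgf: "\<And>c. (\<integral>\<^sup>+ \<omega>. ennreal (exp (\<Sum>i\<in>I. c i * G i \<omega>)) \<partial>M)
      \<le> ennreal (exp (L / 2 * (\<Sum>i\<in>I. (c i)\<^sup>2)))"
  shows "(\<integral>\<^sup>+ \<omega>. ennreal (exp ((\<Sum>i\<in>I. (G i \<omega>)\<^sup>2) / (4 * L))) \<partial>M) \<le> ennreal (sqrt 2 ^ card I)"
proof -
  interpret M: sigma_finite_measure M by fact
  interpret lb: product_sigma_finite "\<lambda>_ :: 'i. lborel :: real measure"
    by (simp add: product_sigma_finite_def sigma_finite_lborel)
  let ?P = "PiM I (\<lambda>_. lborel :: real measure)"
  interpret P: sigma_finite_measure ?P by (rule lb.sigma_finite[OF I])
  interpret pair_sigma_finite M ?P ..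
  \<comment> \<open>This scale makes s^2 / 2 equal to 1 / (4 L), and leaves L s^2 / 2 = 1 / 4, below
    the 1 / 2 at which the Gaussian integral over \<open>z\<close> would diverge.\<close>
  define s where "s = 1 / sqrt (2 * L)"
  have s2: "s\<^sup>2 = 1 / (2 * L)" using L by (simp add: s_def power_divide)
  let ?\<phi> = "\<lambda>z. \<Prod>i\<in>I. std_normal_density (z i)"
  have comp[measurable]: "(\<lambda>x. x i) \<in> borel_measurable ?P" if "i \<in> I" for i
    using measurable_component_singleton[OF that, of "\<lambda>_. lborel"] by simp
  have \<phi>[measurable]: "?\<phi> \<in> borel_measurable ?P"
    by (intro borel_measurable_prod measurable_compose[OF comp]) auto
  have lin: "(\<lambda>(\<omega>, z). \<Sum>i\<in>I. s * z i * G i \<omega>) \<in> borel_measurable (M \<Otimes>\<^sub>M ?P)"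
    unfolding case_prod_beta
    by (intro borel_measurable_sum borel_measurable_times borel_measurable_const
        measurable_compose[OF measurable_snd comp] measurable_compose[OF measurable_fst G])
  have meas: "(\<lambda>(\<omega>, z). ennreal (?\<phi> z * exp (\<Sum>i\<in>I. s * z i * G i \<omega>)))
      \<in> borel_measurable (M \<Otimes>\<^sub>M ?P)"
    using lin measurable_compose[OF measurable_snd \<phi>, of M] unfolding case_prod_beta by measurable
  \<comment> \<open>Factorisation over coordinates, with a general \<open>f\<close> because it is
    used for the linear exponent before the exchange and for the quadratic one after it.\<close>
  have split: "ennreal (?\<phi> z * exp (\<Sum>i\<in>I. f i (z i)))
      = (\<Prod>i\<in>I. ennreal (std_normal_density (z i) * exp (f i (z i))))" for f :: "'i \<Rightarrow> real \<Rightarrow> real" and z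
    by (simp add: exp_sum[OF I] prod.distrib prod_ennreal)
  have "(\<integral>\<^sup>+ \<omega>. ennreal (exp ((\<Sum>i\<in>I. (G i \<omega>)\<^sup>2) / (4 * L))) \<partial>M)
      = (\<integral>\<^sup>+ \<omega>. \<integral>\<^sup>+ z. ennreal (?\<phi> z * exp (\<Sum>i\<in>I. s * z i * G i \<omega>)) \<partial>?P \<partial>M)"
  proof (rule nn_integral_cong)
    fix \<omega>
    have "(\<integral>\<^sup>+ z. ennreal (?\<phi> z * exp (\<Sum>i\<in>I. s * z i * G i \<omega>)) \<partial>?P)
        = (\<integral>\<^sup>+ z. (\<Prod>i\<in>I. ennreal (std_normal_density (z i) * exp ((s * G i \<omega>) * z i))) \<partial>?P)"
      by (subst split[where f = "\<lambda>i x. s * x * G i \<omega>"]) (simp add: mult_ac)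
    also have "\<dots> = (\<Prod>i\<in>I. \<integral>\<^sup>+ x. ennreal (std_normal_density x * exp ((s * G i \<omega>) * x)) \<partial>lborel)"
      by (intro lb.product_nn_integral_prod[OF I]) auto
    also have "\<dots> = (\<Prod>i\<in>I. ennreal (exp ((s * G i \<omega>)\<^sup>2 / 2)))"
      by (simp only: std_normal_mgf)
    also have "\<dots> = ennreal (exp (\<Sum>i\<in>I. (s * G i \<omega>)\<^sup>2 / 2))"
      by (simp add: prod_ennreal exp_sum[OF I])
    also have "(\<Sum>i\<in>I. (s * G i \<omega>)\<^sup>2 / 2) = (\<Sum>i\<in>I. (G i \<omega>)\<^sup>2) / (4 * L)"
      by (simp add: power_mult_distrib s2 sum_divide_distrib)
    finally show "ennreal (exp ((\<Sum>i\<in>I. (G i \<omega>)\<^sup>2) / (4 * L)))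
      = (\<integral>\<^sup>+ z. ennreal (?\<phi> z * exp (\<Sum>i\<in>I. s * z i * G i \<omega>)) \<partial>?P)" ..
  qed
  also have "\<dots> = (\<integral>\<^sup>+ z. \<integral>\<^sup>+ \<omega>. ennreal (?\<phi> z * exp (\<Sum>i\<in>I. s * z i * G i \<omega>)) \<partial>M \<partial>?P)"
    by (rule Fubini'[OF meas, symmetric])
  also have "\<dots> \<le> (\<integral>\<^sup>+ z. ennreal (?\<phi> z * exp (\<Sum>i\<in>I. (z i)\<^sup>2 / 4)) \<partial>?P)"
  proof (rule nn_integral_mono)
    fix z
    have nn: "?\<phi> z \<ge> 0" by (intro prod_nonneg) auto
    have "(\<integral>\<^sup>+ \<omega>. ennreal (?\<phi> z * exp (\<Sum>i\<in>I. s * z i * G i \<omega>)) \<partial>M)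
       = ennreal (?\<phi> z) * (\<integral>\<^sup>+ \<omega>. ennreal (exp (\<Sum>i\<in>I. s * z i * G i \<omega>)) \<partial>M)"
      using nn G by (subst nn_integral_cmult[symmetric]) (auto simp: ennreal_mult)
    also have "\<dots> \<le> ennreal (?\<phi> z) * ennreal (exp (L / 2 * (\<Sum>i\<in>I. (s * z i)\<^sup>2)))"
      by (intro mult_left_mono mgf) auto
    also have "L / 2 * (\<Sum>i\<in>I. (s * z i)\<^sup>2) = (\<Sum>i\<in>I. (z i)\<^sup>2 / 4)"
      using L by (simp add: power_mult_distrib s2 sum_distrib_left)
    finally show "(\<integral>\<^sup>+ \<omega>. ennreal (?\<phi> z * exp (\<Sum>i\<in>I. s * z i * G i \<omega>)) \<partial>M)
       \<le> ennreal (?\<phi> z * exp (\<Sum>i\<in>I. (z i)\<^sup>2 / 4))"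
      using nn by (simp add: ennreal_mult)
  qed
  also have "\<dots> = (\<integral>\<^sup>+ z. (\<Prod>i\<in>I. ennreal (std_normal_density (z i) * exp ((z i)\<^sup>2 / 4))) \<partial>?P)"
    by (subst split[where f = "\<lambda>i x. x\<^sup>2 / 4"]) simp
  also have "\<dots> = (\<Prod>i\<in>I. \<integral>\<^sup>+ x. ennreal (std_normal_density x * exp (x\<^sup>2 / 4)) \<partial>lborel)"
    by (intro lb.product_nn_integral_prod[OF I]) auto
  also have "\<dots> = ennreal (sqrt 2 ^ card I)"
    by (simp add: std_normal_exp_square ennreal_power)
  finally show ?thesis .
qed

text \<open>Markov's inequality for the exponential of the squared norm divided by 4 L; the level
  \<open>r\<close> refers to the squared norm.\<close>

lemma subgaussian_norm_tail:
  fixes G :: "'i \<Rightarrow> 'w \<Rightarrow> real"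
  assumes "prob_space M" and I: "finite I" and L: "L > 0"
    and G: "\<And>i. i \<in> I \<Longrightarrow> G i \<in> borel_measurable M"
    and mgf: "\<And>c. (\<integral>\<^sup>+ \<omega>. ennreal (exp (\<Sum>i\<in>I. c i * G i \<omega>)) \<partial>M)
      \<le> ennreal (exp (L / 2 * (\<Sum>i\<in>I. (c i)\<^sup>2)))"
  shows "measure M {\<omega> \<in> space M. r \<le> (\<Sum>i\<in>I. (G i \<omega>)\<^sup>2)} \<le> sqrt 2 ^ card I * exp (- r / (4 * L))"
proof -
  interpret prob_space M by fact
  let ?N = "\<lambda>\<omega>. \<Sum>i\<in>I. (G i \<omega>)\<^sup>2" and ?S = "{\<omega> \<in> space M. r \<le> (\<Sum>i\<in>I. (G i \<omega>)\<^sup>2)}"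
  have N[measurable]: "?N \<in> borel_measurable M" using G by measurable
  have "ennreal (exp (r / (4 * L))) * emeasure M ?S
      = (\<integral>\<^sup>+ \<omega>. ennreal (exp (r / (4 * L))) * indicator ?S \<omega> \<partial>M)"
    by (rule nn_integral_cmult_indicator[symmetric]) measurable
  also have "\<dots> \<le> (\<integral>\<^sup>+ \<omega>. ennreal (exp (?N \<omega> / (4 * L))) \<partial>M)"
    using L by (intro nn_integral_mono) (auto simp: indicator_def divide_right_mono)
  also have "\<dots> \<le> ennreal (sqrt 2 ^ card I)"
    by (rule subgaussian_exp_square[OF sigma_finite_measure_axioms I L G mgf])
  finally have "ennreal (exp (r / (4 * L)) * measure M ?S) \<le> ennreal (sqrt 2 ^ card I)"
    by (simp add: emeasure_eq_measure ennreal_mult)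
  then have "exp (r / (4 * L)) * measure M ?S \<le> sqrt 2 ^ card I" by simp
  then have "exp (- (r / (4 * L))) * (exp (r / (4 * L)) * measure M ?S)
      \<le> exp (- (r / (4 * L))) * sqrt 2 ^ card I"
    by (intro mult_left_mono) auto
  then show ?thesis by (simp add: mult.assoc[symmetric] exp_minus mult_ac)
qed

section \<open>The Frobenius inner product\<close>

text \<open>Both dimensions are read off the first argument. Summing over index pairs matches the
  index set of \<open>entry_space\<close> and of the sub-Gaussian lemmas.\<close>

definition frob_inner :: "real mat \<Rightarrow> real mat \<Rightarrow> real" where
  "frob_inner A B = (\<Sum>x\<in>{..<dim_row A} \<times> {..<dim_col A}. A $$ x * B $$ x)"

lemma frob_inner_eq:
  "A \<in> carrier_mat a b \<Longrightarrow> frob_inner A B = (\<Sum>i<a. \<Sum>j<b. A $$ (i, j) * B $$ (i, j))"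
  by (auto simp: frob_inner_def sum.cartesian_product intro!: sum.cong)

lemma frob_inner_self: "frob_inner A A = (frob_norm A)\<^sup>2"
proof -
  have "(frob_norm A)\<^sup>2 = (\<Sum>i<dim_row A. \<Sum>j<dim_col A. (A $$ (i, j))\<^sup>2)"
    unfolding frob_norm_def by (rule real_sqrt_pow2) (intro sum_nonneg, simp)
  then show ?thesis
    by (simp add: frob_inner_eq[of A "dim_row A" "dim_col A"] power2_eq_square)
qed

lemma frob_norm_sq:
  "A \<in> carrier_mat a b \<Longrightarrow> (frob_norm A)\<^sup>2 = (\<Sum>x\<in>{..<a} \<times> {..<b}. (A $$ x)\<^sup>2)"
  unfolding frob_inner_self[symmetric] frob_inner_def by (simp add: power2_eq_square)

lemma frob_norm_nonneg [simp]: "frob_norm A \<ge> 0"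
  unfolding frob_norm_def by (intro real_sqrt_ge_zero sum_nonneg) simp

lemma frob_inner_commute:
  "A \<in> carrier_mat a b \<Longrightarrow> B \<in> carrier_mat a b \<Longrightarrow> frob_inner A B = frob_inner B A"
  by (simp add: frob_inner_def mult.commute)

lemma frob_inner_Cauchy_Schwarz:
  assumes "A \<in> carrier_mat a b" "B \<in> carrier_mat a b"
  shows "\<bar>frob_inner A B\<bar> \<le> frob_norm A * frob_norm B"
proof -
  have "(frob_inner A B)\<^sup>2 \<le> frob_inner A A * frob_inner B B"
    using Cauchy_Schwarz_ineq_sum[of "($$) A" "($$) B" "{..<a} \<times> {..<b}"] assms
    by (simp add: frob_inner_def power2_eq_square)
  also have "\<dots> = (frob_norm A * frob_norm B)\<^sup>2"
    by (simp add: frob_inner_self power_mult_distrib)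
  finally show ?thesis
    by (simp add: abs_le_square_iff[symmetric])
qed

lemma frob_inner_diff_left:
  assumes "A \<in> carrier_mat a b" "B \<in> carrier_mat a b"
  shows "frob_inner (A - B) Z = frob_inner A Z - frob_inner B Z"
proof -
  have "A - B \<in> carrier_mat a b" using assms by (simp add: minus_carrier_mat)
  then show ?thesis
    using assms by (simp add: frob_inner_eq[of _ a b] sum_subtractf left_diff_distrib)
qed

lemma frob_inner_transpose:
  assumes "A \<in> carrier_mat a b" "B \<in> carrier_mat a b"
  shows "frob_inner (transpose_mat A) (transpose_mat B) = frob_inner A B"
proof -
  have "frob_inner (transpose_mat A) (transpose_mat B) = (\<Sum>j<b. \<Sum>i<a. A $$ (i, j) * B $$ (i, j))"
    using assms by (subst frob_inner_eq[of _ b a]) auto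
  also have "\<dots> = frob_inner A B"
    using assms by (subst sum.swap) (simp add: frob_inner_eq[of _ a b])
  finally show ?thesis .
qed

text \<open>Replaces the trace in \<open>mn_density\<close> by an inner product, the form in which
  all later estimates are made.\<close>

lemma mat_trace_mult_transpose:
  assumes "A \<in> carrier_mat a b" "B \<in> carrier_mat a b"
  shows "mat_trace (A * transpose_mat B) = frob_inner A B"
  using assms
  by (simp add: mat_trace_def frob_inner_eq[of _ a b] scalar_prod_def lessThan_atLeast0)

text \<open>An interchange of sums. It takes the design matrix off the coefficient matrix and
  thereby produces the score.\<close>

lemma frob_inner_mult_left:
  assumes X: "X \<in> carrier_mat n p" and D: "D \<in> carrier_mat p q" and Z: "Z \<in> carrier_mat n q"
  shows "frob_inner (X * D) Z = frob_inner D (transpose_mat X * Z)"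
proof -
  have "frob_inner (X * D) Z = (\<Sum>i<n. \<Sum>j<q. \<Sum>l<p. X $$ (i, l) * D $$ (l, j) * Z $$ (i, j))"
    using X D Z
    by (subst frob_inner_eq[of _ n q]) (auto simp: scalar_prod_def sum_distrib_right lessThan_atLeast0)
  also have "\<dots> = (\<Sum>j<q. \<Sum>l<p. \<Sum>i<n. X $$ (i, l) * D $$ (l, j) * Z $$ (i, j))"
    by (subst sum.swap, rule sum.cong[OF refl], rule sum.swap)
  also have "\<dots> = (\<Sum>l<p. \<Sum>j<q. \<Sum>i<n. X $$ (i, l) * D $$ (l, j) * Z $$ (i, j))"
    by (rule sum.swap)
  also have "\<dots> = frob_inner D (transpose_mat X * Z)"
    using X D Z
    by (subst frob_inner_eq[of _ p q])
      (auto simp: scalar_prod_def sum_distrib_left lessThan_atLeast0 mult_ac intro!: sum.cong)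
  finally show ?thesis .
qed

text \<open>Transposing brings a weight acting from the right to the left, where the columnwise
  bounds for quadratic forms can be used.\<close>

lemma frob_inner_mult_right:
  assumes Y: "Y \<in> carrier_mat n q" and C: "C \<in> carrier_mat q q" and Z: "Z \<in> carrier_mat n q"
  shows "frob_inner (Y * C) Z = frob_inner (transpose_mat Y) (C * transpose_mat Z)"
proof -
  have "frob_inner (Y * C) Z = frob_inner (transpose_mat C * transpose_mat Y) (transpose_mat Z)"
    using frob_inner_transpose[of "Y * C" n q Z] Y C Z by (simp add: transpose_mult[OF Y C])
  also have "\<dots> = frob_inner (transpose_mat Y) (C * transpose_mat Z)"
    using Y C Z by (subst frob_inner_mult_left[of _ q q]) auto
  finally show ?thesis .
qed

lemma frob_inner_cols:
  assumes "A \<in> carrier_mat a b" "B \<in> carrier_mat a b"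
  shows "frob_inner A B = (\<Sum>j<b. col A j \<bullet> col B j)"
  using assms
  by (subst frob_inner_eq[of _ a b], simp, subst sum.swap)
    (auto simp: scalar_prod_def lessThan_atLeast0 intro!: sum.cong)

text \<open>Since the form splits over the columns of \<open>D\<close>, bounds for vectors carry
  over to matrices with the same constant.\<close>

lemma frob_inner_form_cols:
  assumes D: "D \<in> carrier_mat p q" and A: "A \<in> carrier_mat p p"
  shows "frob_inner D (A * D) = (\<Sum>j<q. col D j \<bullet> (A *\<^sub>v col D j))"
  using frob_inner_cols[of D p q "A * D"] assms by (simp add: mult_mat_vec_def)

lemma frob_inner_form_lower:
  assumes D: "D \<in> carrier_mat p q" and A: "A \<in> carrier_mat p p"
    and le: "\<And>v. v \<in> carrier_vec p \<Longrightarrow> \<kappa> * (v \<bullet> v) \<le> v \<bullet> (A *\<^sub>v v)"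
  shows "\<kappa> * (frob_norm D)\<^sup>2 \<le> frob_inner D (A * D)"
  unfolding frob_inner_form_cols[OF D A] frob_inner_self[symmetric] frob_inner_cols[OF D D]
    sum_distrib_left
  by (intro sum_mono le) (use D in auto)

lemma frob_inner_form_upper:
  assumes D: "D \<in> carrier_mat p q" and A: "A \<in> carrier_mat p p"
    and le: "\<And>v. v \<in> carrier_vec p \<Longrightarrow> v \<bullet> (A *\<^sub>v v) \<le> \<kappa> * (v \<bullet> v)"
  shows "frob_inner D (A * D) \<le> \<kappa> * (frob_norm D)\<^sup>2"
  unfolding frob_inner_form_cols[OF D A] frob_inner_self[symmetric] frob_inner_cols[OF D D]
    sum_distrib_left
  by (intro sum_mono le) (use D in auto)

lemma frob_norm_transpose:
  "A \<in> carrier_mat a b \<Longrightarrow> frob_norm (transpose_mat A) = frob_norm A"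
  using frob_inner_transpose[of A a b A]
  by (simp add: frob_inner_self abs_eq_iff power2_eq_iff_nonneg)

lemma frob_norm_mult_sq:
  assumes X: "X \<in> carrier_mat n p" and D: "D \<in> carrier_mat p q"
  shows "(frob_norm (X * D))\<^sup>2 = frob_inner D ((transpose_mat X * X) * D)"
  using frob_inner_mult_left[OF X D, of "X * D"] X D
  by (simp add: frob_inner_self assoc_mult_mat[of _ p n])

text \<open>Expansion of a square, where symmetry of \<open>C\<close> merges the two cross terms. It
  completes the square in the moment generating function and also separates the linear and quadratic
  parts of the log-likelihood ratio.\<close>

lemma weighted_form_diff:
  assumes Y: "Y \<in> carrier_mat n q" and H: "H \<in> carrier_mat n q"
    and C: "C \<in> carrier_mat q q" "transpose_mat C = C"
  shows "frob_inner ((Y - H) * C) (Y - H)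
    = frob_inner (Y * C) Y - 2 * frob_inner H (Y * C) + frob_inner (H * C) H"
proof -
  have sym: "frob_inner (H * C) Y = frob_inner H (Y * C)"
    using frob_inner_mult_right[OF H C(1) Y] frob_inner_mult_right[OF Y C(1) H]
      frob_inner_transpose[of "Y * C" n q H] frob_inner_commute[of "Y * C" n q H]
      frob_inner_transpose[of H n q "Y * C"] Y H C
    by (simp add: transpose_mult[OF Y C(1)])
  have "(Y - H) * C = Y * C - H * C"
    using Y H C by (simp add: minus_mult_distrib_mat)
  then have "frob_inner ((Y - H) * C) (Y - H) = frob_inner (Y * C) (Y - H) - frob_inner (H * C) (Y - H)"
    using Y H C by (simp add: frob_inner_diff_left[of _ n q])
  moreover have "frob_inner (Z * C) (Y - H) = frob_inner (Z * C) Y - frob_inner (Z * C) H"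
    if Z: "Z \<in> carrier_mat n q" for Z
    using Y H C Z frob_inner_diff_left[OF Y H, of "Z * C"]
    by (simp add: frob_inner_commute[of "Z * C" n q] minus_carrier_mat)
  ultimately show ?thesis
    using Y H C sym by (simp add: frob_inner_commute[of H n q])
qed

section \<open>Measurability of matrix operations\<close>

text \<open>The entries form a measurable map into \<open>entry_space\<close>, and
  \<open>mat\<close> rebuilds \<open>F\<close> from them.\<close>

lemma measurable_into_mat_space:
  assumes car: "\<And>\<omega>. \<omega> \<in> space N \<Longrightarrow> F \<omega> \<in> carrier_mat a b"
    and ent: "\<And>i j. i < a \<Longrightarrow> j < b \<Longrightarrow> (\<lambda>\<omega>. F \<omega> $$ (i, j)) \<in> borel_measurable N"
  shows "F \<in> measurable N (mat_space a b)"
proof -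
  have "(\<lambda>\<omega>. \<lambda>x\<in>{..<a} \<times> {..<b}. F \<omega> $$ x) \<in> measurable N (entry_space a b)"
    by (rule measurable_restrict) (auto intro: ent)
  then have "(\<lambda>\<omega>. mat a b (\<lambda>x\<in>{..<a} \<times> {..<b}. F \<omega> $$ x)) \<in> measurable N (mat_space a b)"
    by (rule measurable_compose[OF _ measurable_mat_entry_space])
  moreover have "mat a b (\<lambda>x\<in>{..<a} \<times> {..<b}. F \<omega> $$ x) = F \<omega>" if "\<omega> \<in> space N" for \<omega>
    using car[OF that] by (intro eq_matI) auto
  ultimately show ?thesis
    by (rule measurable_cong[THEN iffD1, rotated])
qed

lemma measurable_mat_space_carrier:
  "F \<in> measurable N (mat_space a b) \<Longrightarrow> \<omega> \<in> space N \<Longrightarrow> F \<omega> \<in> carrier_mat a b"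
  using measurable_space[of F N "mat_space a b" \<omega>] by (simp add: space_mat_space)

lemma measurable_mat_space_entry:
  "F \<in> measurable N (mat_space a b) \<Longrightarrow> i < a \<Longrightarrow> j < b \<Longrightarrow>
    (\<lambda>\<omega>. F \<omega> $$ (i, j)) \<in> borel_measurable N"
  by (rule measurable_compose[OF _ measurable_mat_entry])

lemma measurable_mat_const: "A \<in> carrier_mat a b \<Longrightarrow> (\<lambda>_. A) \<in> measurable N (mat_space a b)"
  by (rule measurable_const) (simp add: space_mat_space)

lemma measurable_mat_diff:
  assumes F: "F \<in> measurable N (mat_space a b)" and G: "G \<in> measurable N (mat_space a b)"
  shows "(\<lambda>\<omega>. F \<omega> - G \<omega>) \<in> measurable N (mat_space a b)"
proof (rule measurable_into_mat_space)
  note car = measurable_mat_space_carrier[OF F] measurable_mat_space_carrier[OF G]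
  show "F \<omega> - G \<omega> \<in> carrier_mat a b" if "\<omega> \<in> space N" for \<omega>
    using car[OF that] by auto
  fix i j assume ij: "i < a" "j < b"
  have "(\<lambda>\<omega>. F \<omega> $$ (i, j) - G \<omega> $$ (i, j)) \<in> borel_measurable N"
    by (intro borel_measurable_diff measurable_mat_space_entry[OF F] measurable_mat_space_entry[OF G] ij)
  then show "(\<lambda>\<omega>. (F \<omega> - G \<omega>) $$ (i, j)) \<in> borel_measurable N"
    by (rule measurable_cong[THEN iffD1, rotated]) (use car ij in fastforce)
qed

lemma measurable_mat_mult:
  assumes F: "F \<in> measurable N (mat_space a b)" and G: "G \<in> measurable N (mat_space b c)"
  shows "(\<lambda>\<omega>. F \<omega> * G \<omega>) \<in> measurable N (mat_space a c)"
proof (rule measurable_into_mat_space)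
  note car = measurable_mat_space_carrier[OF F] measurable_mat_space_carrier[OF G]
  show "F \<omega> * G \<omega> \<in> carrier_mat a c" if "\<omega> \<in> space N" for \<omega>
    using car[OF that] by auto
  fix i j assume ij: "i < a" "j < c"
  have "(\<lambda>\<omega>. \<Sum>k\<in>{0..<b}. F \<omega> $$ (i, k) * G \<omega> $$ (k, j)) \<in> borel_measurable N"
    by (intro borel_measurable_sum borel_measurable_times measurable_mat_space_entry[OF F]
        measurable_mat_space_entry[OF G] ij) auto
  moreover have "(F \<omega> * G \<omega>) $$ (i, j) = (\<Sum>k\<in>{0..<b}. F \<omega> $$ (i, k) * G \<omega> $$ (k, j))"
    if "\<omega> \<in> space N" for \<omega>
    using car[OF that] ij by (auto simp: scalar_prod_def)
  ultimately show "(\<lambda>\<omega>. (F \<omega> * G \<omega>) $$ (i, j)) \<in> borel_measurable N"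
    by (subst measurable_cong)
qed

lemma measurable_frob_inner:
  assumes F: "F \<in> measurable N (mat_space a b)" and G: "G \<in> measurable N (mat_space a b)"
  shows "(\<lambda>\<omega>. frob_inner (F \<omega>) (G \<omega>)) \<in> borel_measurable N"
proof -
  have "(\<lambda>\<omega>. \<Sum>i<a. \<Sum>j<b. F \<omega> $$ (i, j) * G \<omega> $$ (i, j)) \<in> borel_measurable N"
    by (intro borel_measurable_sum borel_measurable_times measurable_mat_space_entry[OF F]
        measurable_mat_space_entry[OF G]) auto
  then show ?thesis
    by (subst measurable_cong[OF frob_inner_eq[OF measurable_mat_space_carrier[OF F]]])
qed

section \<open>The matrix-normal density\<close>

lemma pos_def_mat_det_nonzero:
  assumes "pos_def_mat q S"
  shows "det S \<noteq> 0"
proof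
  assume "det S = 0"
  moreover have S: "S \<in> carrier_mat q q" using assms by (simp add: pos_def_mat_def)
  ultimately obtain v where "v \<in> carrier_vec q" "v \<noteq> 0\<^sub>v q" "S *\<^sub>v v = 0\<^sub>v q"
    using det_0_iff_vec_prod_zero by blast
  then show False using assms by (force simp: pos_def_mat_def)
qed

text \<open>Symmetry comes from uniqueness of inverses, and nonnegativity from substituting
  \<open>u = mat_inv S *\<^sub>v v\<close>, which turns the form of the inverse into that of
  \<open>S\<close>. The four facts are the premises of \<open>psd_invertible_coercive\<close> for
  the inverse.\<close>

lemma pos_def_mat_inverse:
  assumes pd: "pos_def_mat q S"
  shows "mat_inv S \<in> carrier_mat q q" "transpose_mat (mat_inv S) = mat_inv S" "det (mat_inv S) \<noteq> 0"
    "v \<in> carrier_vec q \<Longrightarrow> v \<bullet> (mat_inv S *\<^sub>v v) \<ge> 0"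
proof -
  have S: "S \<in> carrier_mat q q" "transpose_mat S = S" using pd by (auto simp: pos_def_mat_def)
  note C = mat_inv_of_det_nonzero[OF S(1) pos_def_mat_det_nonzero[OF pd]]
  show "mat_inv S \<in> carrier_mat q q" by (rule C)
  have "transpose_mat (mat_inv S) * S = 1\<^sub>m q"
    using transpose_mult[OF S(1) C(1)] C(2) S(2) by simp
  then have "transpose_mat (mat_inv S) * (S * mat_inv S) = mat_inv S"
    using C S by (subst assoc_mult_mat[of _ q q _ q _ q, symmetric]) auto
  then show "transpose_mat (mat_inv S) = mat_inv S"
    using C by simp
  show "det (mat_inv S) \<noteq> 0"
    using det_mult[OF S(1) C(1)] C(2) by auto
  assume v: "v \<in> carrier_vec q"
  define u where "u = mat_inv S *\<^sub>v v"
  have u: "u \<in> carrier_vec q" using C v by (simp add: u_def)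
  have "S *\<^sub>v u = v"
    unfolding u_def using C S v by (metis assoc_mult_mat_vec one_mult_mat_vec)
  then have "v \<bullet> (mat_inv S *\<^sub>v v) = u \<bullet> (S *\<^sub>v u)"
    using u v by (simp add: u_def[symmetric] comm_scalar_prod[of v q u])
  also have "\<dots> \<ge> 0"
    using pd u S by (cases "u = 0\<^sub>v q") (auto simp: pos_def_mat_def less_imp_le)
  finally show "v \<bullet> (mat_inv S *\<^sub>v v) \<ge> 0" .
qed

lemma mat_inv_one: "mat_inv (1\<^sub>m n) = 1\<^sub>m n"
  using mat_inv_of_det_nonzero[of "1\<^sub>m n" n] by simp

text \<open>Hides the normalising factor in one constant shared by all means and observations. It
  cancels in the posterior and occurs on both sides of the shift identity for the Gaussian
  density.\<close>

lemma mn_density_identity_rows: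
  assumes pd: "pos_def_mat q S"
  obtains K where "K > 0"
    "\<And>M Y. M \<in> carrier_mat n q \<Longrightarrow> Y \<in> carrier_mat n q \<Longrightarrow>
      mn_density M (1\<^sub>m n) S Y = K * exp (- frob_inner ((Y - M) * mat_inv S) (Y - M) / 2)"
proof
  let ?K = "(2 * pi) powr (- (real n * real q) / 2) * det (1\<^sub>m n :: real mat) powr (- real q / 2)
    * det S powr (- real n / 2)"
  \<comment> \<open>\<open>powr\<close> is positive for every nonzero base, so a nonzero determinant
    suffices here.\<close>
  show "?K > 0" using pos_def_mat_det_nonzero[OF pd] by simp
  fix M Y :: "real mat" assume M: "M \<in> carrier_mat n q" and Y: "Y \<in> carrier_mat n q"
  have YM: "Y - M \<in> carrier_mat n q" using M by (rule minus_carrier_mat)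
  have "mat_trace (mat_inv (1\<^sub>m n) * (Y - M) * mat_inv S * transpose_mat (Y - M))
      = frob_inner ((Y - M) * mat_inv S) (Y - M)"
    using mat_trace_mult_transpose[OF mult_carrier_mat[OF YM pos_def_mat_inverse(1)[OF pd]] YM]
    by (simp add: mat_inv_one left_mult_one_mat[OF YM])
  then show "mn_density M (1\<^sub>m n) S Y = ?K * exp (- frob_inner ((Y - M) * mat_inv S) (Y - M) / 2)"
    using M by (simp add: mn_density_def Let_def)
qed

text \<open>Mean and observation may both vary: as a likelihood the density is a function of its
  mean, as the law of the noise a function of the observation.\<close>

lemma measurable_mn_density:
  assumes pd: "pos_def_mat q S"
    and F: "F \<in> measurable N (mat_space n q)" and G: "G \<in> measurable N (mat_space n q)"
  shows "(\<lambda>\<omega>. mn_density (F \<omega>) (1\<^sub>m n) S (G \<omega>)) \<in> borel_measurable N"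
proof -
  obtain K where K: "\<And>M Y. M \<in> carrier_mat n q \<Longrightarrow> Y \<in> carrier_mat n q \<Longrightarrow>
      mn_density M (1\<^sub>m n) S Y = K * exp (- frob_inner ((Y - M) * mat_inv S) (Y - M) / 2)"
    using mn_density_identity_rows[OF pd] by metis
  have GF: "(\<lambda>\<omega>. G \<omega> - F \<omega>) \<in> measurable N (mat_space n q)"
    by (rule measurable_mat_diff[OF G F])
  have [measurable]: "(\<lambda>\<omega>. frob_inner ((G \<omega> - F \<omega>) * mat_inv S) (G \<omega> - F \<omega>)) \<in> borel_measurable N"
    by (intro measurable_frob_inner[of _ _ n q] measurable_mat_mult[of _ _ n q _ q] GF
        measurable_mat_const pos_def_mat_inverse(1)[OF pd])
  have "(\<lambda>\<omega>. K * exp (- frob_inner ((G \<omega> - F \<omega>) * mat_inv S) (G \<omega> - F \<omega>) / 2)) \<in> borel_measurable N"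
    by measurable
  then show ?thesis
    by (subst measurable_cong[OF K[OF measurable_mat_space_carrier[OF F] measurable_mat_space_carrier[OF G]]])
qed

section \<open>Concentration of the score and the posterior\<close>

text \<open>Two successive comparisons: the weight \<open>C\<close> acts on the rows of
  \<open>X * D\<close>, then the Gram matrix of \<open>X\<close> acts on the columns of
  \<open>D\<close>, so the constants multiply.\<close>

lemma weighted_form_bounds:
  assumes X: "X \<in> carrier_mat n p" and D: "D \<in> carrier_mat p q"
    and C: "C \<in> carrier_mat q q" and nn: "\<alpha> \<ge> 0" "\<beta> \<ge> 0"
    and Cb: "\<And>v. v \<in> carrier_vec q \<Longrightarrow> \<alpha> * (v \<bullet> v) \<le> v \<bullet> (C *\<^sub>v v)"
      "\<And>v. v \<in> carrier_vec q \<Longrightarrow> v \<bullet> (C *\<^sub>v v) \<le> \<beta> * (v \<bullet> v)"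
    and Xb: "\<And>v. v \<in> carrier_vec p \<Longrightarrow> a * (v \<bullet> v) \<le> v \<bullet> ((transpose_mat X * X) *\<^sub>v v)"
      "\<And>v. v \<in> carrier_vec p \<Longrightarrow> v \<bullet> ((transpose_mat X * X) *\<^sub>v v) \<le> b * (v \<bullet> v)"
  shows "\<alpha> * a * (frob_norm D)\<^sup>2 \<le> frob_inner (X * D * C) (X * D)"
    and "frob_inner (X * D * C) (X * D) \<le> \<beta> * b * (frob_norm D)\<^sup>2"
proof -
  have XD: "X * D \<in> carrier_mat n q" using X D by simp
  have XX: "transpose_mat X * X \<in> carrier_mat p p" using X by simp
  have eq: "frob_inner (X * D * C) (X * D)
      = frob_inner (transpose_mat (X * D)) (C * transpose_mat (X * D))"
    by (rule frob_inner_mult_right[OF XD C XD])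
  have T: "transpose_mat (X * D) \<in> carrier_mat q n" using XD by simp
  note sq = frob_norm_mult_sq[OF X D]
  have "\<alpha> * (a * (frob_norm D)\<^sup>2) \<le> \<alpha> * (frob_norm (X * D))\<^sup>2"
    unfolding sq using nn(1) by (intro mult_left_mono frob_inner_form_lower[OF D XX Xb(1)])
  also have "\<dots> \<le> frob_inner (X * D * C) (X * D)"
    using frob_inner_form_lower[OF T C Cb(1)] unfolding eq frob_norm_transpose[OF XD] .
  finally show "\<alpha> * a * (frob_norm D)\<^sup>2 \<le> frob_inner (X * D * C) (X * D)" by (simp add: mult_ac)
  have "frob_inner (X * D * C) (X * D) \<le> \<beta> * (frob_norm (X * D))\<^sup>2"
    using frob_inner_form_upper[OF T C Cb(2)] unfolding eq frob_norm_transpose[OF XD] .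
  also have "\<dots> \<le> \<beta> * (b * (frob_norm D)\<^sup>2)"
    unfolding sq using nn(2) by (intro mult_left_mono frob_inner_form_upper[OF D XX Xb(2)])
  finally show "frob_inner (X * D * C) (X * D) \<le> \<beta> * b * (frob_norm D)\<^sup>2" by (simp add: mult_ac)
qed

text \<open>Tilting the centred density by \<open>H\<close> gives a multiple of its translate by
  \<open>H\<close>. The translate has total mass 1 by translation invariance and because the density
  is the law of \<open>E\<close> under a probability measure, so no Gaussian integral is
  computed.\<close>

lemma matrix_normal_mgf:
  assumes pd: "pos_def_mat q S" and "prob_space M"
    and dist: "distributed M (mat_space n q) E (\<lambda>Y. ennreal (mn_density (0\<^sub>m n q) (1\<^sub>m n) S Y))"
    and H: "H \<in> carrier_mat n q"
  shows "(\<integral>\<^sup>+ \<omega>. ennreal (exp (frob_inner H (E \<omega> * mat_inv S))) \<partial>M)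
    = ennreal (exp (frob_inner (H * mat_inv S) H / 2))"
proof -
  interpret prob_space M by fact
  let ?C = "mat_inv S" and ?f = "mn_density (0\<^sub>m n q) (1\<^sub>m n) S"
  note C = pos_def_mat_inverse(1,2)[OF pd]
  have id: "(\<lambda>Y. Y) \<in> measurable (mat_space n q) (mat_space n q)" by simp
  have zero: "(\<lambda>_. 0\<^sub>m n q) \<in> measurable (mat_space n q) (mat_space n q)"
    by (rule measurable_mat_const) simp
  have f: "(\<lambda>Y. ennreal (?f Y)) \<in> borel_measurable (mat_space n q)"
    using measurable_mn_density[OF pd zero id] by simp
  have fH: "(\<lambda>Y. ennreal (?f (Y - H))) \<in> borel_measurable (mat_space n q)"
    using measurable_mn_density[OF pd zero measurable_mat_diff[OF id measurable_mat_const[OF H]]] by simp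
  have "(\<lambda>Y. frob_inner H (Y * ?C)) \<in> borel_measurable (mat_space n q)"
    by (rule measurable_frob_inner[OF measurable_mat_const[OF H]
          measurable_mat_mult[OF id measurable_mat_const[OF C(1)]]])
  then have g: "(\<lambda>Y. ennreal (exp (frob_inner H (Y * ?C)))) \<in> borel_measurable (mat_space n q)"
    by simp
  obtain K where K: "K > 0" "\<And>M Y. M \<in> carrier_mat n q \<Longrightarrow> Y \<in> carrier_mat n q \<Longrightarrow>
      mn_density M (1\<^sub>m n) S Y = K * exp (- frob_inner ((Y - M) * ?C) (Y - M) / 2)"
    using mn_density_identity_rows[OF pd] by metis
  have f_eq: "?f Y = K * exp (- frob_inner (Y * ?C) Y / 2)" if "Y \<in> carrier_mat n q" for Y
  proof -
    have "Y - 0\<^sub>m n q = Y" using that by (intro eq_matI) auto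
    then show ?thesis using K(2)[of "0\<^sub>m n q" Y] that by simp
  qed
  \<comment> \<open>Completing the square.\<close>
  have shift: "?f Y * exp (frob_inner H (Y * ?C)) = exp (frob_inner (H * ?C) H / 2) * ?f (Y - H)"
    if Y: "Y \<in> carrier_mat n q" for Y
    using weighted_form_diff[OF Y H C] f_eq[OF Y] f_eq[OF minus_carrier_mat[OF H], of Y]
    by (simp add: exp_add[symmetric] field_simps)
  have f_nonneg: "?f Y \<ge> 0" if "Y \<in> carrier_mat n q" for Y
    using f_eq[OF that] K(1) by simp
  have "(\<integral>\<^sup>+ \<omega>. ennreal (exp (frob_inner H (E \<omega> * ?C))) \<partial>M)
      = (\<integral>\<^sup>+ Y. ennreal (?f Y) * ennreal (exp (frob_inner H (Y * ?C))) \<partial>mat_space n q)"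
    by (rule distributed_nn_integral[OF dist g, symmetric])
  also have "\<dots> = (\<integral>\<^sup>+ Y. ennreal (exp (frob_inner (H * ?C) H / 2)) * ennreal (?f (Y - H)) \<partial>mat_space n q)"
    using shift f_nonneg H
    by (intro nn_integral_cong) (simp add: space_mat_space ennreal_mult[symmetric] minus_carrier_mat)
  also have "\<dots> = ennreal (exp (frob_inner (H * ?C) H / 2)) * (\<integral>\<^sup>+ Y. ennreal (?f (Y - H)) \<partial>mat_space n q)"
    by (rule nn_integral_cmult[OF fH])
  also have "(\<integral>\<^sup>+ Y. ennreal (?f (Y - H)) \<partial>mat_space n q) = (\<integral>\<^sup>+ Y. ennreal (?f Y) * 1 \<partial>mat_space n q)"
    using nn_integral_mat_space_translation[OF f fH H] by simp
  also have "\<dots> = (\<integral>\<^sup>+ \<omega>. 1 \<partial>M)"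
    by (rule distributed_nn_integral[OF dist]) simp
  finally show ?thesis by (simp add: emeasure_space_1)
qed

lemma measurable_score:
  assumes pd: "pos_def_mat q S" and E: "E \<in> measurable M (mat_space n q)"
    and X: "X \<in> carrier_mat n p"
  shows "(\<lambda>\<omega>. transpose_mat X * (E \<omega> * mat_inv S)) \<in> measurable M (mat_space p q)"
proof -
  have XT: "transpose_mat X \<in> carrier_mat p n" using X by simp
  show ?thesis
    by (rule measurable_mat_mult[OF measurable_mat_const[OF XT]
          measurable_mat_mult[OF E measurable_mat_const[OF pos_def_mat_inverse(1)[OF pd]]]])
qed

text \<open>A linear combination of the entries of the score, with coefficients packed into a matrix
  \<open>D\<close>, is the inner product of \<open>X * D\<close> with the weighted noise. Its moment
  generating function is known exactly, and \<open>form\<close> makes the entries sub-Gaussian with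
  constant \<open>L\<close>.\<close>

lemma score_norm_tail:
  assumes pd: "pos_def_mat q S" and "prob_space M"
    and dist: "distributed M (mat_space n q) E (\<lambda>Y. ennreal (mn_density (0\<^sub>m n q) (1\<^sub>m n) S Y))"
    and X: "X \<in> carrier_mat n p" and L: "L > 0"
    and form: "\<And>D. D \<in> carrier_mat p q \<Longrightarrow>
      frob_inner (X * D * mat_inv S) (X * D) \<le> L * (frob_norm D)\<^sup>2"
  shows "measure M {\<omega> \<in> space M. r \<le> (frob_norm (transpose_mat X * (E \<omega> * mat_inv S)))\<^sup>2}
      \<le> sqrt 2 ^ (p * q) * exp (- r / (4 * L))"
proof -
  let ?C = "mat_inv S" and ?I = "{..<p} \<times> {..<q}"
  let ?G = "\<lambda>\<omega>. transpose_mat X * (E \<omega> * ?C)"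
  have E: "E \<in> measurable M (mat_space n q)" using dist by (rule distributed_measurable)
  note C = pos_def_mat_inverse(1)[OF pd]
  note Gm = measurable_score[OF pd E X]
  have Gc: "?G \<omega> \<in> carrier_mat p q" if "\<omega> \<in> space M" for \<omega>
    by (rule measurable_mat_space_carrier[OF Gm that])
  have norm: "(frob_norm (?G \<omega>))\<^sup>2 = (\<Sum>x\<in>?I. (?G \<omega> $$ x)\<^sup>2)" if "\<omega> \<in> space M" for \<omega>
    by (rule frob_norm_sq[OF Gc[OF that]])
  have "{\<omega> \<in> space M. r \<le> (frob_norm (?G \<omega>))\<^sup>2} = {\<omega> \<in> space M. r \<le> (\<Sum>x\<in>?I. (?G \<omega> $$ x)\<^sup>2)}"
    using norm by auto
  moreover have "measure M {\<omega> \<in> space M. r \<le> (\<Sum>x\<in>?I. (?G \<omega> $$ x)\<^sup>2)}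
      \<le> sqrt 2 ^ card ?I * exp (- r / (4 * L))"
  proof (rule subgaussian_norm_tail[OF \<open>prob_space M\<close> _ L])
    show "(\<lambda>\<omega>. ?G \<omega> $$ x) \<in> borel_measurable M" if "x \<in> ?I" for x
      using that measurable_mat_space_entry[OF Gm] by auto
    fix c :: "nat \<times> nat \<Rightarrow> real"
    define D where "D = mat p q c"
    have D: "D \<in> carrier_mat p q" by (simp add: D_def)
    have XD: "X * D \<in> carrier_mat n q" using X D by simp
    have "(\<integral>\<^sup>+ \<omega>. ennreal (exp (\<Sum>x\<in>?I. c x * ?G \<omega> $$ x)) \<partial>M)
        = (\<integral>\<^sup>+ \<omega>. ennreal (exp (frob_inner (X * D) (E \<omega> * ?C))) \<partial>M)"
    proof (rule nn_integral_cong)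
      fix \<omega> assume "\<omega> \<in> space M"
      then have "E \<omega> \<in> carrier_mat n q" by (rule measurable_mat_space_carrier[OF E])
      then have "frob_inner (X * D) (E \<omega> * ?C) = frob_inner D (?G \<omega>)"
        using C by (intro frob_inner_mult_left[OF X D]) simp
      also have "\<dots> = (\<Sum>x\<in>?I. c x * ?G \<omega> $$ x)"
        unfolding frob_inner_def D_def by (auto intro!: sum.cong)
      finally show "ennreal (exp (\<Sum>x\<in>?I. c x * ?G \<omega> $$ x))
        = ennreal (exp (frob_inner (X * D) (E \<omega> * ?C)))" by simp
    qed
    also have "\<dots> = ennreal (exp (frob_inner (X * D * ?C) (X * D) / 2))"
      by (rule matrix_normal_mgf[OF pd \<open>prob_space M\<close> dist XD])
    also have "\<dots> \<le> ennreal (exp (L / 2 * (frob_norm D)\<^sup>2))"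
      using form[OF D] by (intro ennreal_leI) simp
    also have "(frob_norm D)\<^sup>2 = (\<Sum>x\<in>?I. (c x)\<^sup>2)"
      unfolding frob_inner_self[symmetric] frob_inner_def D_def
      by (auto simp: power2_eq_square intro!: sum.cong)
    finally show "(\<integral>\<^sup>+ \<omega>. ennreal (exp (\<Sum>x\<in>?I. c x * ?G \<omega> $$ x)) \<partial>M)
      \<le> ennreal (exp (L / 2 * (\<Sum>x\<in>?I. (c x)\<^sup>2)))" .
  qed auto
  ultimately show "measure M {\<omega> \<in> space M. r \<le> (frob_norm (?G \<omega>))\<^sup>2}
      \<le> sqrt 2 ^ (p * q) * exp (- r / (4 * L))"
    by (simp add: card_cartesian_product)
qed

lemma add_diff_mat_eq:
  assumes "(B :: real mat) \<in> carrier_mat a b" "A \<in> carrier_mat a b" "N \<in> carrier_mat a b"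
  shows "A + N - B = N - (B - A)"
  using assms by (intro eq_matI) auto

text \<open>Deterministic, for one fixed noise matrix \<open>N\<close>: the likelihood is at most
  some \<open>A\<close> outside the \<epsilon>-ball and at least some \<open>B\<close> on a ball of
  prior mass at least \<open>m\<close>, so the posterior mass outside is at most A / (B m), the
  prior having total mass 1.\<close>

lemma posterior_tail_bound:
  assumes pd: "pos_def_mat q S" and X: "X \<in> carrier_mat n p" and B0: "B0 \<in> carrier_mat p q"
    and prior: "prior \<in> borel_measurable (mat_space p q)"
      "(\<integral>\<^sup>+ B. ennreal (prior B) \<partial>mat_space p q) = 1"
    and N: "N \<in> carrier_mat n q"
    and lower: "\<And>D. D \<in> carrier_mat p q \<Longrightarrow>
      a * (frob_norm D)\<^sup>2 \<le> frob_inner (X * D * mat_inv S) (X * D)"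
    and upper: "\<And>D. D \<in> carrier_mat p q \<Longrightarrow>
      frob_inner (X * D * mat_inv S) (X * D) \<le> b * (frob_norm D)\<^sup>2"
    and a: "a \<ge> 0" and b: "b \<ge> 0" and \<epsilon>: "\<epsilon> > 0" and \<gamma>: "\<gamma> \<le> a * \<epsilon> / 4"
    and score: "frob_norm (transpose_mat X * (N * mat_inv S)) \<le> \<gamma>"
    and ball: "measure (prior_measure p q prior)
      {B \<in> space (mat_space p q). frob_norm (B - B0) < r} \<ge> m" and m: "m > 0"
  shows "measure (posterior_measure X S q prior (X * B0 + N))
      {B \<in> space (mat_space p q). frob_norm (B - B0) > \<epsilon>}
    \<le> exp (- (a * \<epsilon>\<^sup>2 / 4) + (\<gamma> * r + b * r\<^sup>2 / 2)) / m"
    (is "measure ?Q ?S \<le> _")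
proof -
  let ?C = "mat_inv S" and ?U = "{B \<in> space (mat_space p q). frob_norm (B - B0) < r}"
  let ?P = "prior_measure p q prior"
  let ?G = "transpose_mat X * (N * ?C)"
  define lik where "lik = (\<lambda>B. mn_density (X * B) (1\<^sub>m n) S (X * B0 + N))"
  define Z where "Z = (\<integral>\<^sup>+ B. ennreal (lik B) \<partial>?P)"
  note C = pos_def_mat_inverse(1,2)[OF pd]
  have sets_P [measurable_cong]: "sets ?P = sets (mat_space p q)" and space_P: "space ?P = carrier_mat p q"
    by (simp_all add: prior_measure_def space_mat_space)
  have "emeasure ?P (space ?P)
      = (\<integral>\<^sup>+ B. ennreal (prior B) * indicator (space (mat_space p q)) B \<partial>mat_space p q)"
    using prior(1) unfolding prior_measure_def by (subst emeasure_density) auto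
  also have "\<dots> = (\<integral>\<^sup>+ B. ennreal (prior B) \<partial>mat_space p q)"
    by (rule nn_integral_cong) simp
  finally have P1: "emeasure ?P (space ?P) = 1" using prior(2) by simp
  interpret P: prob_space ?P by (rule prob_spaceI[OF P1])
  have Y: "X * B0 + N \<in> carrier_mat n q" using X B0 N by simp
  have id: "(\<lambda>B. B) \<in> measurable (mat_space p q) (mat_space p q)" by simp
  have "lik \<in> borel_measurable (mat_space p q)"
    unfolding lik_def
    by (rule measurable_mn_density[OF pd measurable_mat_mult[OF measurable_mat_const[OF X] id]
          measurable_mat_const[OF Y]])
  then have lik_meas [measurable]: "lik \<in> borel_measurable ?P"
    by (simp add: measurable_cong_sets[OF sets_P refl])
  have Q: "?Q = density ?P (\<lambda>B. ennreal (lik B) / Z)"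
    using X by (simp add: posterior_measure_def lik_def Z_def Let_def)
  obtain K0 where K0: "K0 > 0" "\<And>M Y. M \<in> carrier_mat n q \<Longrightarrow> Y \<in> carrier_mat n q \<Longrightarrow>
      mn_density M (1\<^sub>m n) S Y = K0 * exp (- frob_inner ((Y - M) * ?C) (Y - M) / 2)"
    using mn_density_identity_rows[OF pd] by metis
  \<comment> \<open>The likelihood at the truth, where the residual is \<open>N\<close>.\<close>
  define K where "K = K0 * exp (- frob_inner (N * ?C) N / 2)"
  have K: "K > 0" using K0(1) by (simp add: K_def)
  have lik_eq: "lik B = K * exp (frob_inner (B - B0) ?G - frob_inner (X * (B - B0) * ?C) (X * (B - B0)) / 2)"
    if B: "B \<in> carrier_mat p q" for B
  proof -
    have D: "B - B0 \<in> carrier_mat p q" using B0 by (rule minus_carrier_mat)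
    have XD: "X * (B - B0) \<in> carrier_mat n q" using X D by simp
    have XD': "X * (B - B0) = X * B - X * B0"
      using X B B0 by (simp add: mult_minus_distrib_mat)
    have "X * B \<in> carrier_mat n q" "X * B0 \<in> carrier_mat n q" using X B B0 by auto
    then have res: "X * B0 + N - X * B = N - X * (B - B0)"
      unfolding XD' using N by (rule add_diff_mat_eq)
    have "frob_inner (X * (B - B0)) (N * ?C) = frob_inner (B - B0) ?G"
      using N C by (intro frob_inner_mult_left[OF X D]) simp
    then have "lik B = K0 * exp (- (frob_inner (N * ?C) N - 2 * frob_inner (B - B0) ?G
        + frob_inner (X * (B - B0) * ?C) (X * (B - B0))) / 2)"
      unfolding lik_def using X B Y by (subst K0(2)) (simp_all add: res weighted_form_diff[OF N XD C])
    also have "- (frob_inner (N * ?C) N - 2 * frob_inner (B - B0) ?G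
        + frob_inner (X * (B - B0) * ?C) (X * (B - B0))) / 2
      = - frob_inner (N * ?C) N / 2
        + (frob_inner (B - B0) ?G - frob_inner (X * (B - B0) * ?C) (X * (B - B0)) / 2)"
      by (simp add: field_simps)
    finally show ?thesis unfolding K_def exp_add by simp
  qed
  have G: "?G \<in> carrier_mat p q" using X N C by simp
  have inner_le: "\<bar>frob_inner (B - B0) ?G\<bar> \<le> frob_norm (B - B0) * \<gamma>" if "B \<in> carrier_mat p q" for B
    using frob_inner_Cauchy_Schwarz[OF minus_carrier_mat[OF B0] G, of B] score
      mult_left_mono[OF score frob_norm_nonneg[of "B - B0"]] by simp
  have \<gamma>0: "\<gamma> \<ge> 0" using score frob_norm_nonneg[of ?G] by linarith
  \<comment> \<open>By the choice of \<open>\<gamma>\<close> the linear term takes up at most half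
    of the quadratic one, leaving a |D|^2 / 4 in the exponent.\<close>
  have far: "lik B \<le> K * exp (- (a * \<epsilon>\<^sup>2 / 4))"
    if B: "B \<in> carrier_mat p q" and x: "frob_norm (B - B0) > \<epsilon>" for B
  proof -
    let ?x = "frob_norm (B - B0)"
    have "frob_inner (B - B0) ?G \<le> ?x * (a * ?x / 4)"
    proof -
      have "a * \<epsilon> \<le> a * ?x" using a x by (intro mult_left_mono) auto
      then have "?x * \<gamma> \<le> ?x * (a * ?x / 4)" using \<gamma> by (intro mult_left_mono) auto
      with inner_le[OF B] show ?thesis by linarith
    qed
    moreover have "a * ?x\<^sup>2 \<le> frob_inner (X * (B - B0) * ?C) (X * (B - B0))"
      by (rule lower[OF minus_carrier_mat[OF B0]])
    moreover have "a * \<epsilon>\<^sup>2 \<le> a * ?x\<^sup>2"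
      using a x \<epsilon> by (intro mult_left_mono power_mono) auto
    ultimately have "frob_inner (B - B0) ?G - frob_inner (X * (B - B0) * ?C) (X * (B - B0)) / 2
        \<le> - (a * \<epsilon>\<^sup>2 / 4)"
      by (simp add: power2_eq_square algebra_simps)
    then show ?thesis using K by (simp add: lik_eq[OF B])
  qed
  \<comment> \<open>Near the truth both terms are bounded by their worst values at radius
    \<open>r\<close>.\<close>
  have near: "K * exp (- (\<gamma> * r + b * r\<^sup>2 / 2)) \<le> lik B"
    if B: "B \<in> carrier_mat p q" and x: "frob_norm (B - B0) < r" for B
  proof -
    let ?x = "frob_norm (B - B0)"
    have "?x * \<gamma> \<le> r * \<gamma>" using x \<gamma>0 by (intro mult_right_mono) auto
    moreover have "frob_inner (X * (B - B0) * ?C) (X * (B - B0)) \<le> b * ?x\<^sup>2"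
      by (rule upper[OF minus_carrier_mat[OF B0]])
    moreover have "b * ?x\<^sup>2 \<le> b * r\<^sup>2"
      using b x by (intro mult_left_mono power_mono) auto
    ultimately have "- (\<gamma> * r + b * r\<^sup>2 / 2)
        \<le> frob_inner (B - B0) ?G - frob_inner (X * (B - B0) * ?C) (X * (B - B0)) / 2"
      using inner_le[OF B] by (simp add: mult.commute[of r])
    then show ?thesis using K by (simp add: lik_eq[OF B])
  qed
  define A where "A = K * exp (- (a * \<epsilon>\<^sup>2 / 4))"
  define B where "B = K * exp (- (\<gamma> * r + b * r\<^sup>2 / 2))"
  have A0: "A > 0" and B0': "B > 0" using K by (auto simp: A_def B_def)
  \<comment> \<open>Non-measurable sets have measure 0, so the mass hypothesis itself gives measurability.\<close>
  have U: "?U \<in> sets ?P"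
  proof (rule ccontr)
    assume "?U \<notin> sets ?P"
    then show False using ball m by (simp add: measure_notin_sets)
  qed
  have "ennreal (B * m) \<le> ennreal B * emeasure ?P ?U"
    using ball B0' m by (simp add: P.emeasure_eq_measure ennreal_mult[symmetric])
  also have "\<dots> = (\<integral>\<^sup>+ x. ennreal B * indicator ?U x \<partial>?P)"
    using U by (simp add: nn_integral_cmult_indicator)
  also have "\<dots> \<le> Z"
    unfolding Z_def B_def using near
    by (intro nn_integral_mono) (auto simp: indicator_def space_mat_space intro!: ennreal_leI)
  finally have Z: "ennreal (B * m) \<le> Z" .
  have "emeasure ?Q ?S \<le> ennreal (A / (B * m))"
  \<comment> \<open>A set outside the sigma-algebra has measure 0, so the bound holds in that case
    as well.\<close>
  proof (cases "?S \<in> sets ?P")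
    case True
    then have "emeasure ?Q ?S = (\<integral>\<^sup>+ x. ennreal (lik x) / Z * indicator ?S x \<partial>?P)"
      unfolding Q by (intro emeasure_density) auto
    also have "\<dots> \<le> (\<integral>\<^sup>+ x. ennreal A / Z \<partial>?P)"
      unfolding A_def using far
      by (intro nn_integral_mono)
        (auto simp: indicator_def space_mat_space intro!: ennreal_leI divide_right_mono_ennreal)
    also have "\<dots> = ennreal A / Z" by (simp add: P1)
    also have "\<dots> \<le> ennreal (A / (B * m))"
    \<comment> \<open>For infinite evidence the quotient is 0; otherwise the lower bound on
      \<open>Z\<close> applies.\<close>
    proof (cases Z rule: ennreal_cases)
      case (real z)
      then have "B * m \<le> z" using Z by simp
      moreover have "B * m > 0" using B0' m by simp
      ultimately show ?thesis
        using A0 real by (auto simp: divide_ennreal intro!: ennreal_leI divide_left_mono)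
    qed simp
    finally show ?thesis .
  next
    case False
    then have "?S \<notin> sets ?Q" by (simp add: Q)
    then show ?thesis by (simp add: emeasure_notin_sets)
  qed
  then have "measure ?Q ?S \<le> A / (B * m)"
    unfolding measure_def using A0 B0' m by (intro enn2real_leI) auto
  also have "A / (B * m) = exp (- (a * \<epsilon>\<^sup>2 / 4) + (\<gamma> * r + b * r\<^sup>2 / 2)) / m"
  proof -
    have "K * exp (- s) / (K * exp (- t) * m) = exp (- s + t) / m" for s t
      using K by (simp add: exp_diff exp_minus field_simps)
    then show ?thesis unfolding A_def B_def .
  qed
  finally show ?thesis .
qed

text \<open>The bridge from eigenvalues of the normalised Gram matrix to quadratic forms; undoing
  the factor 1 / n makes the constants grow linearly in \<open>n\<close>.\<close>

lemma gram_form_bounds: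
  assumes X: "X \<in> carrier_mat n p" and n: "n \<ge> 1" and v: "v \<in> carrier_vec p"
  shows "c \<le> lambda_min ((1 / real n) \<cdot>\<^sub>m (transpose_mat X * X)) \<Longrightarrow>
      (real n * c) * (v \<bullet> v) \<le> v \<bullet> ((transpose_mat X * X) *\<^sub>v v)"
    and "lambda_max ((1 / real n) \<cdot>\<^sub>m (transpose_mat X * X)) \<le> c \<Longrightarrow>
      v \<bullet> ((transpose_mat X * X) *\<^sub>v v) \<le> (real n * c) * (v \<bullet> v)"
proof -
  define A where "A = transpose_mat X * X"
  let ?A = "(1 / real n) \<cdot>\<^sub>m A"
  have A: "A \<in> carrier_mat p p" and "transpose_mat A = A"
    using X by (auto simp: A_def transpose_mult[of _ p n])
  then have A': "?A \<in> carrier_mat p p" "transpose_mat ?A = ?A"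
    by (auto intro!: eq_matI) (metis carrier_matD index_transpose_mat(1))+
  have "?A *\<^sub>v v = (1 / real n) \<cdot>\<^sub>v (A *\<^sub>v v)"
    using A v by (intro eq_vecI) (auto simp: scalar_prod_def sum_divide_distrib)
  then have form: "v \<bullet> (?A *\<^sub>v v) = (v \<bullet> (A *\<^sub>v v)) / real n"
    using A v by simp
  have vv: "v \<bullet> v \<ge> 0" by simp
  show "(real n * c) * (v \<bullet> v) \<le> v \<bullet> (A *\<^sub>v v)" if "c \<le> lambda_min ?A"
  proof -
    have "c * (v \<bullet> v) \<le> (v \<bullet> (A *\<^sub>v v)) / real n"
      using lambda_min_le_form[OF A' v] mult_right_mono[OF that vv] by (simp add: form)
    then show ?thesis using n by (simp add: field_simps)
  qed
  show "v \<bullet> (A *\<^sub>v v) \<le> (real n * c) * (v \<bullet> v)" if "lambda_max ?A \<le> c"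
  proof -
    have "(v \<bullet> (A *\<^sub>v v)) / real n \<le> c * (v \<bullet> v)"
      using form_le_lambda_max[OF A' v] mult_right_mono[OF that vv] by (simp add: form)
    then show ?thesis using n by (simp add: field_simps)
  qed
qed

theorem theorem1:
  fixes q :: nat and \<Sigma> :: "real mat"
    and p :: "nat \<Rightarrow> nat" and X :: "nat \<Rightarrow> real mat" and B0 :: "nat \<Rightarrow> real mat"
    and \<pi> :: "nat \<Rightarrow> real mat \<Rightarrow> real"
    and M :: "'w measure" and E :: "nat \<Rightarrow> 'w \<Rightarrow> real mat"
    and c1 c2 d1 d2 \<epsilon> \<rho> :: real
  assumes q_pos: "q \<ge> 1"
    and Sigma_pd: "pos_def_mat q \<Sigma>"
    and X_dim: "\<And>n. n \<ge> 1 \<Longrightarrow> X n \<in> carrier_mat n (p n)"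
    and B0_dim: "\<And>n. n \<ge> 1 \<Longrightarrow> B0 n \<in> carrier_mat (p n) q"
    and prior_meas: "\<And>n. n \<ge> 1 \<Longrightarrow> \<pi> n \<in> borel_measurable (mat_space (p n) q)"
    and prior_nonneg: "\<And>n B. n \<ge> 1 \<Longrightarrow> \<pi> n B \<ge> 0"
    and prior_norm: "\<And>n. n \<ge> 1 \<Longrightarrow> (\<integral>\<^sup>+ B. ennreal (\<pi> n B) \<partial>mat_space (p n) q) = 1"
    and prob: "prob_space M"
    and noise: "\<And>n. n \<ge> 1 \<Longrightarrow>
       distributed M (mat_space n q) (E n) (\<lambda>Y. ennreal (mn_density (0\<^sub>m n q) (1\<^sub>m n) \<Sigma> Y))"
    and A1_o: "(\<lambda>n. real (p n)) \<in> o(\<lambda>n. real n)"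
    and A1_le: "\<And>n. n \<ge> 1 \<Longrightarrow> p n \<le> n"
    and A2: "0 < c1"
      "ereal c1 < liminf (\<lambda>n. ereal (lambda_min ((1 / real n) \<cdot>\<^sub>m (transpose_mat (X n) * X n))))"
      "liminf (\<lambda>n. ereal (lambda_min ((1 / real n) \<cdot>\<^sub>m (transpose_mat (X n) * X n))))
         \<le> limsup (\<lambda>n. ereal (lambda_max ((1 / real n) \<cdot>\<^sub>m (transpose_mat (X n) * X n))))"
      "limsup (\<lambda>n. ereal (lambda_max ((1 / real n) \<cdot>\<^sub>m (transpose_mat (X n) * X n)))) < ereal c2"
    and A3: "0 < d1" "d1 < lambda_min \<Sigma>" "lambda_min \<Sigma> \<le> lambda_max \<Sigma>"
      "lambda_max \<Sigma> < d2"
    and eps_pos: "\<epsilon> > 0"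
    and rho_pos: "\<rho> > 0"
    and prior_mass: "\<And>\<Delta> k. 0 < \<Delta> \<Longrightarrow>
       \<Delta> < \<epsilon>^2 * c1 * sqrt d1 / (48 * sqrt c2 * d2) \<Longrightarrow>
       0 < k \<Longrightarrow> k < \<epsilon>^2 * c1 / (32 * d2) - 3 * \<Delta> * sqrt c2 / (2 * sqrt d1) \<Longrightarrow>
       eventually (\<lambda>n. measure (prior_measure (p n) q (\<pi> n))
            {B \<in> space (mat_space (p n) q). frob_norm (B - B0 n) < \<Delta> / real n powr (\<rho> / 2)}
          > exp (- k * real n)) sequentially"
  shows "AE \<omega> in M.
     (\<lambda>n. measure (posterior_measure (X n) \<Sigma> q (\<pi> n) (X n * B0 n + E n \<omega>))
            {B \<in> space (mat_space (p n) q). frob_norm (B - B0 n) > \<epsilon>}) \<longlonglongrightarrow> 0"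
proof -
  interpret prob_space M by (rule prob)
  let ?C = "mat_inv \<Sigma>"
  let ?G = "\<lambda>n \<omega>. transpose_mat (X n) * (E n \<omega> * ?C)"
  note C = pos_def_mat_inverse[OF Sigma_pd]
  \<comment> \<open>\<open>\<alpha>\<close> and \<open>\<beta>\<close> bound the form of the
    precision matrix; all rates below are expressed through them.\<close>
  obtain \<alpha> where \<alpha>: "\<alpha> > 0" "\<And>v. v \<in> carrier_vec q \<Longrightarrow> \<alpha> * (v \<bullet> v) \<le> v \<bullet> (?C *\<^sub>v v)"
    using psd_invertible_coercive[OF C(1,2,4,3)] by blast
  obtain \<beta> where \<beta>: "\<beta> > 0" "\<And>v. v \<in> carrier_vec q \<Longrightarrow> \<bar>v \<bullet> (?C *\<^sub>v v)\<bar> \<le> \<beta> * (v \<bullet> v)"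
    using quadratic_form_bounded[OF C(1)] by blast
  have \<beta>': "v \<bullet> (?C *\<^sub>v v) \<le> \<beta> * (v \<bullet> v)" if "v \<in> carrier_vec q" for v
    using \<beta>(2)[OF that] by linarith
  have "ereal c1 < ereal c2" using less_le_trans[OF A2(2,3)] A2(4) by (rule less_trans)
  then have c2: "c2 > 0" using A2(1) by simp
  have d2: "d2 > 0" using A3 by linarith

  \<comment> \<open>Two-sided bounds of order n on the quadratic form, for large n\<close>
  have form: "eventually (\<lambda>n. \<forall>D\<in>carrier_mat (p n) q.
      \<alpha> * (real n * c1) * (frob_norm D)\<^sup>2 \<le> frob_inner (X n * D * ?C) (X n * D) \<and>
      frob_inner (X n * D * ?C) (X n * D) \<le> \<beta> * (real n * c2) * (frob_norm D)\<^sup>2) sequentially"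
    using less_LiminfD[OF A2(2)] Limsup_lessD[OF A2(4)] eventually_ge_at_top[of 1]
  proof eventually_elim
    case (elim n)
    show ?case
    proof (intro ballI conjI)
      fix D :: "real mat" assume D: "D \<in> carrier_mat (p n) q"
      note bounds = weighted_form_bounds[OF X_dim[OF elim(3)] D C(1) _ _ \<alpha>(2) \<beta>'
          gram_form_bounds(1)[OF X_dim[OF elim(3)] elim(3)]
          gram_form_bounds(2)[OF X_dim[OF elim(3)] elim(3)], of c1 c2]
      show "\<alpha> * (real n * c1) * (frob_norm D)\<^sup>2 \<le> frob_inner (X n * D * ?C) (X n * D)"
        using \<alpha>(1) \<beta>(1) elim by (intro bounds(1)) auto
      show "frob_inner (X n * D * ?C) (X n * D) \<le> \<beta> * (real n * c2) * (frob_norm D)\<^sup>2"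
        using \<alpha>(1) \<beta>(1) elim by (intro bounds(2)) auto
    qed
  qed

  \<comment> \<open>Choice of the constants\<close>
  define \<delta> where "\<delta> = \<alpha> * c1 * \<epsilon> / 4"
  \<comment> \<open>With a = \<alpha> n c1, the score threshold \<delta> n is a \<epsilon> / 4, the
    largest value that \<open>posterior_tail_bound\<close> admits, and \<eta> n = a \<epsilon>^2 / 4
    is the exponent gained outside the \<epsilon>-ball.\<close>
  define \<eta> where "\<eta> = \<alpha> * c1 * \<epsilon>\<^sup>2 / 4"
  \<comment> \<open>The Gaussian tail exponent at level \<delta> n is 2 \<theta> n: one half absorbs
    the dimension factor, the other gives geometric decay.\<close>
  define \<theta> where "\<theta> = \<delta>\<^sup>2 / (8 * (\<beta> * c2))"
  have pos: "\<delta> > 0" "\<eta> > 0" "\<theta> > 0"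
    using \<alpha>(1) \<beta>(1) c2 A2(1) eps_pos by (auto simp: \<delta>_def \<eta>_def \<theta>_def)

  define \<Delta>0 where "\<Delta>0 = \<epsilon>\<^sup>2 * c1 * sqrt d1 / (48 * sqrt c2 * d2)"
  have \<Delta>0: "\<Delta>0 > 0" using eps_pos A2(1) A3(1) c2 d2 by (simp add: \<Delta>0_def)
  \<comment> \<open>The three bounds keep \<open>\<Delta>\<close> strictly inside the range of the
    prior mass assumption, give r^2 <= \<Delta> for radii r <= \<Delta>, and limit the loss of
    likelihood near the truth to a quarter of \<open>\<eta>\<close>.\<close>
  define \<Delta> where "\<Delta> = min (\<Delta>0 / 2) (min 1 (\<eta> / (4 * (\<delta> + \<beta> * c2))))"
  have s: "\<delta> + \<beta> * c2 > 0" using pos \<beta>(1) c2 by (simp add: add_pos_pos)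
  have \<Delta>: "\<Delta> > 0" "\<Delta> < \<Delta>0" "\<Delta> \<le> 1" "(\<delta> + \<beta> * c2) * \<Delta> \<le> \<eta> / 4"
  proof -
    have "\<Delta> \<le> \<Delta>0 / 2" "\<Delta> \<le> 1" and le: "\<Delta> \<le> \<eta> / (4 * (\<delta> + \<beta> * c2))"
      unfolding \<Delta>_def by linarith+
    then show "\<Delta> < \<Delta>0" "\<Delta> \<le> 1" using \<Delta>0 by auto
    show "(\<delta> + \<beta> * c2) * \<Delta> \<le> \<eta> / 4" using le s by (simp add: field_simps)
    show "\<Delta> > 0" using pos s \<Delta>0 by (simp add: \<Delta>_def)
  qed
  \<comment> \<open>The admissible range of \<open>k\<close> is nonempty because its upper end would
    be exactly 0 at \<open>\<Delta>0\<close> and \<open>\<Delta>\<close> is smaller.\<close>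
  define k0 where "k0 = \<epsilon>\<^sup>2 * c1 / (32 * d2) - 3 * \<Delta> * sqrt c2 / (2 * sqrt d1)"
  have "3 * \<Delta> * sqrt c2 / (2 * sqrt d1) < 3 * \<Delta>0 * sqrt c2 / (2 * sqrt d1)"
    using \<Delta>(2) c2 A3(1) by (simp add: divide_strict_right_mono)
  also have "\<dots> = \<epsilon>\<^sup>2 * c1 / (32 * d2)"
    using c2 A3(1) d2 by (simp add: \<Delta>0_def field_simps)
  finally have k0: "k0 > 0" by (simp add: k0_def)
  \<comment> \<open>The prior mass may cost another quarter of \<open>\<eta>\<close>.\<close>
  define k where "k = min (k0 / 2) (\<eta> / 4)"
  have k: "k > 0" "k < k0" "k \<le> \<eta> / 4" using k0 pos by (auto simp: k_def)
  have mass: "eventually (\<lambda>n. measure (prior_measure (p n) q (\<pi> n))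
      {B \<in> space (mat_space (p n) q). frob_norm (B - B0 n) < \<Delta> / real n powr (\<rho> / 2)}
        > exp (- k * real n)) sequentially"
    using \<Delta>(1,2) k(1,2) by (intro prior_mass) (simp_all add: \<Delta>0_def k0_def)

  \<comment> \<open>Almost sure control of the score\<close>
  define A where "A = (\<lambda>n. {\<omega> \<in> space M. n \<ge> 1 \<and> (\<delta> * real n)\<^sup>2 \<le> (frob_norm (?G n \<omega>))\<^sup>2})"
  \<comment> \<open>The clause n >= 1 makes \<open>A 0\<close> empty, so it is measurable although
    the noise is specified from index 1 on.\<close>
  have A_sets: "A n \<in> sets M" for n
  proof (cases "n \<ge> 1")
    case True
    have "?G n \<in> measurable M (mat_space (p n) q)"
      by (rule measurable_score[OF Sigma_pd distributed_measurable[OF noise[OF True]] X_dim[OF True]])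
    then have [measurable]: "(\<lambda>\<omega>. (frob_norm (?G n \<omega>))\<^sup>2) \<in> borel_measurable M"
      using measurable_frob_inner[of "?G n" M "p n" q "?G n"] by (simp add: frob_inner_self)
    show ?thesis using True by (simp add: A_def)
  qed (simp add: A_def)
  \<comment> \<open>The sublinear growth of \<open>p\<close> is used with the constant \<theta> / q,
    so that eventually p q <= \<theta> n.\<close>
  have "eventually (\<lambda>n. norm (real (p n)) \<le> \<theta> / real q * norm (real n)) sequentially"
    using pos q_pos by (intro landau_o.smallD[OF A1_o]) simp
  then have tail: "eventually (\<lambda>n. norm (measure M (A n)) \<le> exp (- \<theta>) ^ n) sequentially"
    using form eventually_ge_at_top[of 1]
  proof eventually_elim
    case (elim n)
    have n: "real n > 0" using elim(3) by simp
    have L: "\<beta> * (real n * c2) > 0" using \<beta>(1) c2 n by simp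
    have "measure M (A n) \<le> sqrt 2 ^ (p n * q) * exp (- (\<delta> * real n)\<^sup>2 / (4 * (\<beta> * (real n * c2))))"
      using score_norm_tail[OF Sigma_pd prob noise[OF elim(3)] X_dim[OF elim(3)] L, of "(\<delta> * real n)\<^sup>2"]
        elim(2,3) by (simp add: A_def)
    also have "- (\<delta> * real n)\<^sup>2 / (4 * (\<beta> * (real n * c2))) = - (2 * \<theta> * real n)"
      using n \<beta>(1) c2 by (simp add: \<theta>_def field_simps power2_eq_square)
    \<comment> \<open>Replacing sqrt 2 by e is crude but harmless, as p q is eventually below
      \<theta> n.\<close>
    also have "sqrt 2 ^ (p n * q) \<le> exp 1 ^ (p n * q)"
    proof (rule power_mono)
      have "sqrt 2 \<le> 2" by (rule real_le_lsqrt) auto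
      also have "2 \<le> exp (1 :: real)" using exp_ge_add_one_self[of 1] by simp
      finally show "sqrt 2 \<le> exp 1" .
    qed simp
    also have "exp 1 ^ (p n * q) = exp (real (p n) * real q)"
      by (simp add: exp_of_nat_mult[symmetric])
    also have "\<dots> \<le> exp (\<theta> * real n)"
      using elim(1) q_pos by (simp add: field_simps)
    finally have "measure M (A n) \<le> exp (\<theta> * real n) * exp (- (2 * \<theta> * real n))"
      by (simp add: mult_right_mono)
    also have "\<dots> = exp (- \<theta>) ^ n"
      by (simp add: exp_add[symmetric] exp_of_nat_mult[symmetric] algebra_simps)
    finally show ?case by simp
  qed
  have "summable (\<lambda>n. measure M (A n))"
    by (rule summable_comparison_test_ev[OF tail summable_geometric]) (use pos in simp)
  \<comment> \<open>First Borel-Cantelli lemma, which asks for summability and not for independence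
    across \<open>n\<close>.\<close>
  then have "AE \<omega> in M. eventually (\<lambda>n. \<omega> \<in> space M - A n) sequentially"
    by (intro borel_cantelli_AE1 A_sets) (auto simp: emeasure_eq_measure)

  \<comment> \<open>Exponential decay of the posterior along a fixed noise path\<close>
  then show ?thesis
  proof (rule AE_mp, intro AE_I2 impI)
    fix \<omega> assume \<omega>: "\<omega> \<in> space M" and ev: "eventually (\<lambda>n. \<omega> \<in> space M - A n) sequentially"
    let ?post = "\<lambda>n. measure (posterior_measure (X n) \<Sigma> q (\<pi> n) (X n * B0 n + E n \<omega>))
            {B \<in> space (mat_space (p n) q). frob_norm (B - B0 n) > \<epsilon>}"
    have "eventually (\<lambda>n. norm (?post n) \<le> exp (- (\<eta> / 2)) ^ n) sequentially"
      using ev mass form eventually_ge_at_top[of 1]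
    proof eventually_elim
      case (elim n)
      note n = elim(4)
      define r where "r = \<Delta> / real n powr (\<rho> / 2)"
      \<comment> \<open>As n^(\<rho> / 2) >= 1, the radius \<open>r\<close> of the prior ball never
        exceeds \<open>\<Delta>\<close>.\<close>
      have w: "real n powr (\<rho> / 2) \<ge> 1" using n rho_pos by (intro ge_one_powr_ge_zero) auto
      then have "\<Delta> * 1 \<le> \<Delta> * real n powr (\<rho> / 2)" using \<Delta>(1) by (intro mult_left_mono) auto
      moreover have "real n powr (\<rho> / 2) > 0" using w by linarith
      ultimately have r: "0 < r" "r \<le> \<Delta>"
        unfolding r_def using \<Delta>(1) by (simp_all only: pos_divide_le_eq divide_pos_pos mult_1_right)
      have "(frob_norm (?G n \<omega>))\<^sup>2 < (\<delta> * real n)\<^sup>2"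
        using elim(1) n by (auto simp: A_def)
      then have score: "frob_norm (?G n \<omega>) \<le> \<delta> * real n"
        using pos(1) power2_less_imp_less[of "frob_norm (?G n \<omega>)" "\<delta> * real n"] by simp
      have N: "E n \<omega> \<in> carrier_mat n q"
        by (rule measurable_mat_space_carrier[OF distributed_measurable[OF noise[OF n]] \<omega>])
      have "?post n \<le> exp (- (\<alpha> * (real n * c1) * \<epsilon>\<^sup>2 / 4)
          + (\<delta> * real n * r + \<beta> * (real n * c2) * r\<^sup>2 / 2)) / exp (- k * real n)"
      proof (rule posterior_tail_bound[OF Sigma_pd X_dim[OF n] B0_dim[OF n] prior_meas[OF n]
              prior_norm[OF n] N _ _ _ _ eps_pos _ score])
        show "exp (- k * real n) \<le> measure (prior_measure (p n) q (\<pi> n))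
            {B \<in> space (mat_space (p n) q). frob_norm (B - B0 n) < r}"
          using elim(2) by (simp add: r_def)
      qed (use elim(3) \<alpha>(1) \<beta>(1) c2 A2(1) in \<open>auto simp: \<delta>_def mult_ac\<close>)
      also have "\<dots> = exp (real n * (- \<eta> + (\<delta> * r + \<beta> * c2 * r\<^sup>2 / 2) + k))"
        by (simp add: \<eta>_def exp_diff[symmetric] algebra_simps)
      also have "\<dots> \<le> exp (real n * (- (\<eta> / 2)))"
      proof -
        have "\<delta> * r \<le> \<delta> * \<Delta>" using pos r by simp
        moreover have "\<beta> * c2 * r\<^sup>2 / 2 \<le> \<beta> * c2 * \<Delta>"
        proof -
          have "r\<^sup>2 \<le> \<Delta>"
            using mult_mono[of r \<Delta> r 1] r \<Delta>(1,3) by (simp add: power2_eq_square)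
          then have "\<beta> * c2 * r\<^sup>2 \<le> \<beta> * c2 * \<Delta>" using \<beta>(1) c2 by simp
          moreover have "0 \<le> \<beta> * c2 * \<Delta>" using \<beta>(1) c2 \<Delta>(1) by simp
          ultimately show ?thesis by linarith
        qed
        \<comment> \<open>Balance of rates: from the gain \<open>\<eta>\<close>, at most \<eta> / 4
          is lost to the likelihood near the truth and \<eta> / 4 to the prior mass.\<close>
        ultimately have "- \<eta> + (\<delta> * r + \<beta> * c2 * r\<^sup>2 / 2) + k \<le> - (\<eta> / 2)"
          using \<Delta>(4) k(3) by (simp add: distrib_right)
        then show ?thesis unfolding exp_le_cancel_iff by (rule mult_left_mono) simp
      qed
      also have "\<dots> = exp (- (\<eta> / 2)) ^ n" by (rule exp_of_nat_mult)
      finally show ?case by simp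
    qed
    moreover have "(\<lambda>n. exp (- (\<eta> / 2)) ^ n) \<longlonglongrightarrow> 0"
      using pos by (intro LIMSEQ_power_zero) simp
    ultimately show "?post \<longlonglongrightarrow> 0" by (rule Lim_null_comparison)
  qed
qed

end
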